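(* For every $w\in S_\mathbb{Z}$ there is a unique polynomial $\widetilde{\mathfrak S}_w=\widetilde{\mathfrak S}_w(c,x,y)\in\Lambda[x,y]$ such that for every positive integer $m$ with $\gamma^m(w)\in S_+$, \[\gamma^m(\widetilde{\mathfrak S}_w)(0,x,y)=\mathfrak S_{\gamma^m(w)}(x;-y).\]
   Context: Let $\Lambda=\mathbb{Z}[c_1,c_2,\ldots]$ be the polynomial ring in indeterminates $c_k$ ($c_k$ of degree $k$), and $\Lambda[x,y]$ the polynomial ring over $\Lambda$ in indeterminates $x_i,y_i$ for all $i\in\mathbb{Z}$ (of degree $1$). Chern-series notation: $c$ stands for the series $\sum_{k\ge0}c_kt^k$ with $c_0=1$; products and quotients of series with constant term $1$ are formal power series in $t$, and an expression such as $c\cdot\prod_i\frac{1+y_i}{1-x_i}$ means $c(t)\prod_i\frac{1+y_it}{1-x_it}$; "sending $c$ to a series $a$" means $c_k\mapsto a_k$ (coefficient of $t^k$) for all $k\ge1$. $S_\mathbb{Z}$ is the group of bijections of $\mathbb{Z}$ fixing all but finitely many integers; $S_+$ is the subgroup of those fixing every integer $\le0$. For $m\in\mathbb{Z}$, $\gamma^m(w)$ is the permutation sending $i+m\mapsto w(i)+m$. Also $\gamma^m$ denotes the ring automorphism of $\Lambda[x,y]$ with $x_i\mapsto x_{i+m}$, $y_i\mapsto y_{i+m}$, and $\gamma^m(c)=c\cdot\prod_{i=1}^m\frac{1+y_i}{1-x_i}$ if $m>0$, $\gamma^m(c)=c\cdot\prod_{i=m+1}^0\frac{1-x_i}{1+y_i}$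 if $m<0$, $\gamma^0=\mathrm{id}$. For $w\in S_+$, $\mathfrak S_w(x;y)$ is the classical Lascoux–Schützenberger double Schubert polynomial in $\mathbb{Z}[x_1,x_2,\ldots,y_1,y_2,\ldots]$ (normalized so that $\mathfrak S_{w_0}(x;y)=\prod_{i+j\le n}(x_i-y_j)$ for the longest element $w_0$ of $S_n$), and $\mathfrak S_w(x;-y)$ is obtained by substituting $-y_j$ for each $y_j$. For $f\in\Lambda[x,y]$, $f(0,x,y)$ denotes the image of $f$ under $c_k\mapsto0$ for all $k$. *)

theory Defs
  imports
    "HOL-Library.Poly_Mapping"
    "HOL-Computational_Algebra.Formal_Power_Series"
    "HOL-Combinatorics.Transposition"
begin

text \<open>
  \<open>\<Lambda>[x,y]\<close> is rendered as the polynomial ring over the integers in all the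
  indeterminates \<open>c\<^sub>1, c\<^sub>2, \<dots>\<close> and \<open>x\<^sub>i, y\<^sub>i\<close> (\<open>i \<in> \<int>\<close>), a polynomial being a finitely
  supported family of integer coefficients indexed by monomials.  Since there is no
  indeterminate \<open>c\<^sub>0\<close>, the indeterminate \<open>c\<^sub>k\<close> with \<open>k \<ge> 1\<close> is \<open>C (k - 1)\<close>.
  The ring \<open>\<int>[x\<^sub>1, x\<^sub>2, \<dots>, y\<^sub>1, y\<^sub>2, \<dots>]\<close> is regarded as a subring of \<open>\<Lambda>[x,y]\<close>.
\<close>

datatype indet = C nat | X int | Y int

type_synonym cxy_poly = "(indet \<Rightarrow>\<^sub>0 nat) \<Rightarrow>\<^sub>0 int"

definition indet :: "indet \<Rightarrow> cxy_poly" where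
  "indet v = Poly_Mapping.single (Poly_Mapping.single v 1) 1"

abbreviation xv :: "int \<Rightarrow> cxy_poly" where "xv i \<equiv> indet (X i)"

abbreviation yv :: "int \<Rightarrow> cxy_poly" where "yv i \<equiv> indet (Y i)"

definition cv :: "nat \<Rightarrow> cxy_poly" where
  "cv k = (case k of 0 \<Rightarrow> 1 | Suc j \<Rightarrow> indet (C j))"

text \<open>The ring homomorphism sending each indeterminate \<open>v\<close> to \<open>\<sigma> v\<close>.\<close>

definition subst :: "(indet \<Rightarrow> cxy_poly) \<Rightarrow> cxy_poly \<Rightarrow> cxy_poly" where
  "subst \<sigma> f =
     (\<Sum>\<mu>\<in>Poly_Mapping.keys f. of_int (Poly_Mapping.lookup f \<mu>) *
        (\<Prod>v\<in>Poly_Mapping.keys \<mu>. \<sigma> v ^ Poly_Mapping.lookup \<mu> v))"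

definition c_zero :: "cxy_poly \<Rightarrow> cxy_poly" where
  "c_zero = subst (\<lambda>v. case v of C k \<Rightarrow> 0 | X i \<Rightarrow> xv i | Y i \<Rightarrow> yv i)"

definition neg_y :: "cxy_poly \<Rightarrow> cxy_poly" where
  "neg_y = subst (\<lambda>v. case v of C k \<Rightarrow> indet (C k) | X i \<Rightarrow> xv i | Y i \<Rightarrow> - yv i)"

definition chern :: "cxy_poly fps" where
  "chern = Abs_fps cv"

text \<open>
  The library's division of power series needs an inverse operation on the
  coefficients, which a polynomial ring lacks, so the quotient by a series with
  constant term 1 goes through its inverse with constant term 1.
\<close>

definition quot :: "cxy_poly fps \<Rightarrow> cxy_poly fps \<Rightarrow> cxy_poly fps" where
  "quot a b = a * fps_right_inverse b 1"

definition gamma_chern :: "int \<Rightarrow> cxy_poly fps" where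
  "gamma_chern m =
     (if m > 0 then
        chern * (\<Prod>i\<in>{1..m}. quot (1 + fps_const (yv i) * fps_X) (1 - fps_const (xv i) * fps_X))
      else if m < 0 then
        chern * (\<Prod>i\<in>{m + 1..0}. quot (1 - fps_const (xv i) * fps_X) (1 + fps_const (yv i) * fps_X))
      else chern)"

definition gamma :: "int \<Rightarrow> cxy_poly \<Rightarrow> cxy_poly" where
  "gamma m = subst (\<lambda>v. case v of
       C k \<Rightarrow> fps_nth (gamma_chern m) (Suc k)
     | X i \<Rightarrow> xv (i + m)
     | Y i \<Rightarrow> yv (i + m))"

definition S_Z :: "(int \<Rightarrow> int) set" where
  "S_Z = {w. bij w \<and> finite {i. w i \<noteq> i}}"

definition S_plus :: "(int \<Rightarrow> int) set" where
  "S_plus = {w \<in> S_Z. \<forall>i\<le>0. w i = i}"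

definition gamma_perm :: "int \<Rightarrow> (int \<Rightarrow> int) \<Rightarrow> (int \<Rightarrow> int)" where
  "gamma_perm m w = (\<lambda>i. w (i - m) + m)"

definition swap_x :: "int \<Rightarrow> cxy_poly \<Rightarrow> cxy_poly" where
  "swap_x i = subst (\<lambda>v. case v of
       C k \<Rightarrow> indet (C k)
     | X j \<Rightarrow> xv (transpose i (i + 1) j)
     | Y j \<Rightarrow> yv j)"

text \<open>
  The divided difference \<open>(f - s\<^sub>i f) / (x\<^sub>i - x\<^sub>i\<^sub>+\<^sub>1)\<close>; the quotient is exact, and it is
  unique as the ring is an integral domain.
\<close>

definition divided_difference :: "int \<Rightarrow> cxy_poly \<Rightarrow> cxy_poly" where
  "divided_difference i f = (THE g. (xv i - xv (i + 1)) * g = f - swap_x i f)"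

definition longest_perm :: "int \<Rightarrow> int \<Rightarrow> int" where
  "longest_perm n = (\<lambda>i. if 1 \<le> i \<and> i \<le> n then n + 1 - i else i)"

text \<open>
  The Lascoux-Schuetzenberger recursion: start from the longest element of some \<open>S\<^sub>n\<close>
  and apply divided differences, with \<open>\<partial>\<^sub>i \<SS>\<^sub>w = \<SS>\<^bsub>w s\<^sub>i\<^esub>\<close> whenever \<open>w(i) > w(i + 1)\<close>.
  By the braid relations and the stability of the construction under
  \<open>S\<^sub>n \<subseteq> S\<^sub>n\<^sub>+\<^sub>1\<close>, the polynomial obtained depends only on the permutation.
\<close>

inductive is_double_schubert :: "(int \<Rightarrow> int) \<Rightarrow> cxy_poly \<Rightarrow> bool" where
  longest: "1 \<le> n \<Longrightarrow>
    is_double_schubert (longest_perm n)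
      (\<Prod>(i, j)\<in>{(i, j). 1 \<le> i \<and> 1 \<le> j \<and> i + j \<le> n}. xv i - yv j)"
| descent: "is_double_schubert w f \<Longrightarrow> 1 \<le> i \<Longrightarrow> w i > w (i + 1) \<Longrightarrow>
    is_double_schubert (w \<circ> transpose i (i + 1)) (divided_difference i f)"

definition double_schubert :: "(int \<Rightarrow> int) \<Rightarrow> cxy_poly" where
  "double_schubert w = (THE f. is_double_schubert w f)"

end

theory Submission
  imports
    Defs
    "HOL-Library.Nat_Bijection"
    "HOL-Computational_Algebra.Fundamental_Theorem_Algebra"
    "HOL-Computational_Algebra.Polynomial_FPS"
    "Jordan_Normal_Form.Determinant"
begin

text \<open>
  The polynomial \<open>\<SS>\<^sub>w\<close> is the unique polynomial of degree at most \<open>\<ell>(w)\<close> in \<open>x\<close> whose localization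
  \<open>x\<^sub>i \<mapsto> y\<^bsub>v(i)\<^esub>\<close> vanishes at every \<open>v \<noteq> w\<close> with \<open>\<ell>(v) \<le> \<ell>(w)\<close> and equals
  \<open>\<Prod>(y\<^sub>a - y\<^sub>b)\<close>, over the inverted pairs of values, at \<open>w\<close>.  This property passes along divided
  differences and holds for dominant permutations.

  For existence, divided differences lift to \<open>\<Lambda>[x,y]\<close> compatibly with the specializations
  \<open>F \<mapsto> \<gamma>\<^sup>m(F)(0,x,y)\<close>, so it is enough to treat the reversals of long intervals.  After \<open>\<gamma>\<^sup>m\<close> their
  double Schubert polynomials are flagged determinants, whose size does not depend on \<open>m\<close> and whose
  entries are coefficients of series coming from \<open>\<Lambda>[x,y]\<close>.

  For uniqueness, given complex values of finitely many indeterminates \<open>c\<^sub>k, x\<^sub>i, y\<^sub>i\<close>, for large \<open>m\<close>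
  one can choose values of the variables so that the specialized indeterminates take the given
  values; a polynomial killed by all specializations thus vanishes at every complex point.
\<close>

text \<open>The group inverse of HOL-Algebra would clash with the inverse function \<open>inv\<close>.\<close>

unbundle no m_inv_syntax

text \<open>The library's proof that \<open>\<Lambda>[x,y]\<close> is an integral domain needs a linear order on the
  indeterminates; any will do.\<close>

instantiation indet :: linorder
begin

primrec indet_code :: "indet \<Rightarrow> nat" where
  "indet_code (C k) = 3 * k"
| "indet_code (X i) = 3 * int_encode i + 1"
| "indet_code (Y i) = 3 * int_encode i + 2"

definition "u \<le> v \<longleftrightarrow> indet_code u \<le> indet_code v"
definition "u < v \<longleftrightarrow> indet_code u < indet_code v"

lemma indet_code_inject: "indet_code u = indet_code v \<Longrightarrow> u = v"
  by (cases u; cases v) (simp_all add: int_encode_eq, presburger+)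

instance
  by standard (auto simp: less_eq_indet_def less_indet_def intro: indet_code_inject)

end

subsection \<open>Evaluation of polynomials\<close>

lemma poly_mapping_induct [case_names single sum]:
  fixes P :: "('a \<Rightarrow>\<^sub>0 'b::monoid_add) \<Rightarrow> bool"
  assumes single: "\<And>k a. P (Poly_Mapping.single k a)"
    and sum: "\<And>p q. P p \<Longrightarrow> P q \<Longrightarrow> P (p + q)"
  shows "P p"
proof (induction p rule: update_induct)
  case const
  then show ?case using single[of _ 0] by simp
next
  case (update f a b)
  have "Poly_Mapping.update a b f = f + Poly_Mapping.single a b"
    using update(1)
    by (intro poly_mapping_eqI) (auto simp: lookup_update lookup_add lookup_single when_def in_keys_iff)
  then show ?case using sum[OF update(3) single] by simp
qed

definition ev_monom :: "(indet \<Rightarrow> 'a::comm_ring_1) \<Rightarrow> (indet \<Rightarrow>\<^sub>0 nat) \<Rightarrow> 'a" where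
  "ev_monom \<rho> \<mu> = (\<Prod>v\<in>Poly_Mapping.keys \<mu>. \<rho> v ^ Poly_Mapping.lookup \<mu> v)"

text \<open>\<open>subst\<close> with values in an arbitrary commutative ring:
  \<open>cxy_poly\<close> itself for substitutions, the complex numbers for the uniqueness
  argument.\<close>

definition ev :: "(indet \<Rightarrow> 'a::comm_ring_1) \<Rightarrow> cxy_poly \<Rightarrow> 'a" where
  "ev \<rho> f = (\<Sum>\<mu>\<in>Poly_Mapping.keys f. of_int (Poly_Mapping.lookup f \<mu>) * ev_monom \<rho> \<mu>)"

lemma subst_eq_ev: "subst \<sigma> = ev \<sigma>"
  by (simp add: fun_eq_iff subst_def ev_def ev_monom_def)

lemma ev_monom_superset:
  assumes "finite A" "Poly_Mapping.keys \<mu> \<subseteq> A"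
  shows "ev_monom \<rho> \<mu> = (\<Prod>v\<in>A. \<rho> v ^ Poly_Mapping.lookup \<mu> v)"
  unfolding ev_monom_def
  by (rule prod.mono_neutral_left) (use assms in \<open>auto simp: in_keys_iff\<close>)

lemma ev_superset:
  assumes "finite A" "Poly_Mapping.keys f \<subseteq> A"
  shows "ev \<rho> f = (\<Sum>\<mu>\<in>A. of_int (Poly_Mapping.lookup f \<mu>) * ev_monom \<rho> \<mu>)"
  unfolding ev_def
  by (rule sum.mono_neutral_left) (use assms in \<open>auto simp: in_keys_iff\<close>)

lemma ev_monom_add: "ev_monom \<rho> (\<mu> + \<nu>) = ev_monom \<rho> \<mu> * ev_monom \<rho> \<nu>"
proof -
  let ?A = "Poly_Mapping.keys \<mu> \<union> Poly_Mapping.keys \<nu>"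
  have "Poly_Mapping.keys (\<mu> + \<nu>) \<subseteq> ?A"
    by (rule Poly_Mapping.keys_add)
  then show ?thesis
    by (simp add: ev_monom_superset[of ?A] lookup_add power_add prod.distrib)
qed

lemma ev_add: "ev \<rho> (f + g) = ev \<rho> f + ev \<rho> g"
proof -
  let ?A = "Poly_Mapping.keys f \<union> Poly_Mapping.keys g"
  have "Poly_Mapping.keys (f + g) \<subseteq> ?A"
    by (rule Poly_Mapping.keys_add)
  then show ?thesis
    by (simp add: ev_superset[of ?A] lookup_add sum.distrib algebra_simps)
qed

lemma ev_single: "ev \<rho> (Poly_Mapping.single \<mu> a) = of_int a * ev_monom \<rho> \<mu>"
  by (simp add: ev_def)

lemma ev_single_mult: "ev \<rho> (Poly_Mapping.single \<mu> a * g) = of_int a * ev_monom \<rho> \<mu> * ev \<rho> g"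
proof (induction g rule: poly_mapping_induct)
  case (single \<nu> b)
  then show ?case by (simp add: mult_single ev_single ev_monom_add mult_ac)
next
  case (sum g h)
  then show ?case by (simp add: ev_add algebra_simps)
qed

lemma ev_mult: "ev \<rho> (f * g) = ev \<rho> f * ev \<rho> g"
proof (induction f rule: poly_mapping_induct)
  case (single \<mu> a)
  then show ?case by (simp add: ev_single_mult ev_single)
next
  case (sum f h)
  then show ?case by (simp add: ev_add algebra_simps)
qed

lemma ev_of_int: "ev \<rho> (of_int n) = of_int n"
proof -
  have "ev \<rho> (Poly_Mapping.single 0 n) = of_int n"
    by (simp add: ev_single ev_monom_def)
  moreover have "Poly_Mapping.single 0 n = (of_int n :: cxy_poly)"
    by (metis single_of_int of_int_eq_id id_apply)
  ultimately show ?thesis by simp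
qed

lemma ev_indet [simp]: "ev \<rho> (indet v) = \<rho> v"
  by (simp add: indet_def ev_single ev_monom_def)

lemma ev_0 [simp]: "ev \<rho> 0 = 0"
  and ev_1 [simp]: "ev \<rho> 1 = 1"
  using ev_of_int[of \<rho> 0] ev_of_int[of \<rho> 1] by simp_all

interpretation ev: comm_ring_hom "ev \<rho>" for \<rho>
  by unfold_locales (simp_all add: ev_add ev_mult)

lemma ev_prod: "ev \<rho> (\<Prod>i\<in>A. f i) = (\<Prod>i\<in>A. ev \<rho> (f i))"
  by (induction A rule: infinite_finite_induct) (simp_all add: ev_mult)

lemma ev_diff: "ev \<rho> (f - g) = ev \<rho> f - ev \<rho> g"
  by (rule ev.hom_minus)

subsection \<open>Subrings generated by indeterminates\<close>

text \<open>The subring generated by the indeterminates in \<open>A\<close>. The product rule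
  multiplies by a single indeterminate only, so that inductions have one simple multiplicative
  step.\<close>

inductive_set gen :: "indet set \<Rightarrow> cxy_poly set" for A where
  gen_int: "of_int n \<in> gen A"
| gen_times: "v \<in> A \<Longrightarrow> f \<in> gen A \<Longrightarrow> indet v * f \<in> gen A"
| gen_add: "f \<in> gen A \<Longrightarrow> g \<in> gen A \<Longrightarrow> f + g \<in> gen A"

lemma gen_0 [simp]: "0 \<in> gen A" and gen_1 [simp]: "1 \<in> gen A"
  using gen_int[of 0 A] gen_int[of 1 A] by simp_all

lemma gen_int_mult:
  assumes "f \<in> gen A"
  shows "of_int n * f \<in> gen A"
  using assms
proof induction
  case (gen_int k)
  then show ?case using gen.gen_int[of "n * k" A] by simp
next
  case (gen_times v f)
  then show ?case using gen.gen_times[of v A "of_int n * f"] by (simp add: mult_ac)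
next
  case (gen_add f g)
  then show ?case by (simp add: distrib_left gen.gen_add)
qed

lemma gen_mult:
  assumes "f \<in> gen A" "g \<in> gen A"
  shows "f * g \<in> gen A"
  using assms(1)
proof induction
  case (gen_int k)
  then show ?case using assms by (simp add: gen_int_mult)
next
  case (gen_times v f)
  then show ?case by (simp add: mult.assoc gen.gen_times)
next
  case (gen_add f h)
  then show ?case by (simp add: distrib_right gen.gen_add)
qed

lemma gen_indet: "v \<in> A \<Longrightarrow> indet v \<in> gen A"
  using gen_times[of v A 1] by simp

lemma gen_mono: "f \<in> gen A \<Longrightarrow> A \<subseteq> B \<Longrightarrow> f \<in> gen B"
  by (induction rule: gen.induct) (auto intro: gen.intros)

lemma gen_finite: "f \<in> gen A \<Longrightarrow> \<exists>B. finite B \<and> B \<subseteq> A \<and> f \<in> gen B"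
proof (induction rule: gen.induct)
  case (gen_int n)
  then show ?case by (auto intro: exI[of _ "{}"] gen.gen_int)
next
  case (gen_times v f)
  then obtain B where "finite B" "B \<subseteq> A" "f \<in> gen B" by blast
  then show ?case using gen_times(1) gen_mono[of f B "insert v B"]
    by (intro exI[of _ "insert v B"]) (auto intro!: gen.gen_times)
next
  case (gen_add f g)
  then obtain B D where "finite B" "B \<subseteq> A" "f \<in> gen B" "finite D" "D \<subseteq> A" "g \<in> gen D" by blast
  then show ?case
    by (intro exI[of _ "B \<union> D"]) (auto intro!: gen.gen_add intro: gen_mono)
qed

text \<open>Turns rule induction over \<open>gen\<close> into an induction principle for all
  polynomials.\<close>

lemma gen_UNIV: "f \<in> gen UNIV"
proof (induction f rule: poly_mapping_induct)
  case (single \<mu> a)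
  have "Poly_Mapping.single \<mu> (1::int) \<in> gen UNIV"
  proof (induction \<mu> rule: poly_mapping_induct)
    case (single v n)
    show ?case
    proof (induction n)
      case 0
      then show ?case by simp
    next
      case (Suc n)
      have "Poly_Mapping.single (Poly_Mapping.single v (Suc n)) (1::int) =
            indet v * Poly_Mapping.single (Poly_Mapping.single v n) 1"
        by (simp add: indet_def mult_single flip: single_add)
      then show ?case using Suc by (simp add: gen_times)
    qed
  next
    case (sum \<mu> \<nu>)
    then have "Poly_Mapping.single \<mu> (1::int) * Poly_Mapping.single \<nu> 1 \<in> gen UNIV"
      by (intro gen_mult)
    then show ?case by (simp add: mult_single)
  qed
  then have "of_int a * Poly_Mapping.single \<mu> 1 \<in> gen UNIV"
    by (rule gen_int_mult)
  moreover have "of_int a * Poly_Mapping.single \<mu> 1 = Poly_Mapping.single \<mu> a"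
    by (simp add: mult_single flip: single_of_int)
  ultimately show ?case by simp
next
  case (sum f g)
  then show ?case by (intro gen_add)
qed

lemma ev_cong_gen:
  assumes "f \<in> gen A" "\<And>v. v \<in> A \<Longrightarrow> \<rho> v = \<sigma> v"
  shows "ev \<rho> f = ev \<sigma> f"
  using assms by (induction rule: gen.induct) (simp_all add: ev_of_int ev_mult ev_add)

lemma ev_ev: "ev \<rho> (ev \<sigma> f) = ev (\<lambda>v. ev \<rho> (\<sigma> v)) f"
  using gen_UNIV[of f] by (induction rule: gen.induct) (simp_all add: ev_of_int ev_mult ev_add)

lemma ev_ident_gen:
  assumes "f \<in> gen A" "\<And>v. v \<in> A \<Longrightarrow> \<sigma> v = indet v"
  shows "ev \<sigma> f = f"
  using assms by (induction rule: gen.induct) (simp_all add: ev_of_int ev_mult ev_add)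

lemma ev_gen:
  assumes "f \<in> gen A" "\<And>v. v \<in> A \<Longrightarrow> \<sigma> v \<in> gen B"
  shows "ev \<sigma> f \<in> gen B"
  using assms
  by (induction rule: gen.induct) (simp_all add: ev_of_int ev_mult ev_add gen_int gen_mult gen.gen_add)

lemma indet_inject: "indet u = indet v \<longleftrightarrow> u = v"
proof
  assume "indet u = indet v"
  then have "ev (\<lambda>x. if x = u then 1 else 0 :: int) (indet u) = ev (\<lambda>x. if x = u then 1 else 0) (indet v)"
    by simp
  then show "u = v" by (simp split: if_splits)
qed simp

text \<open>Modulo \<open>d\<close> the substitution is the identity on the generators, hence
  everywhere. This makes divided differences exact, both the ordinary and the lifted ones.\<close>

lemma ev_diff_dvd:
  assumes "\<And>v. d dvd (indet v - \<sigma> v)"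
  shows "d dvd (f - ev \<sigma> f)"
  using gen_UNIV[of f]
proof (induction rule: gen.induct)
  case (gen_int n)
  then show ?case by (simp add: ev_of_int)
next
  case (gen_times v f)
  have "indet v * f - ev \<sigma> (indet v * f) = indet v * (f - ev \<sigma> f) + (indet v - \<sigma> v) * ev \<sigma> f"
    by (simp add: ev_mult algebra_simps)
  then show ?case using gen_times assms[of v] by simp
next
  case (gen_add f g)
  have "f + g - ev \<sigma> (f + g) = (f - ev \<sigma> f) + (g - ev \<sigma> g)"
    by (simp add: ev_add)
  then show ?case using dvd_add[OF gen_add.IH] by (simp only:)
qed

subsection \<open>Divided differences and the degree in x\<close>

definition swap_indet :: "int \<Rightarrow> indet \<Rightarrow> indet" where
  "swap_indet i v = (case v of X j \<Rightarrow> X (transpose i (i + 1) j) | _ \<Rightarrow> v)"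

lemma swap_x_ev: "swap_x i = ev (\<lambda>v. indet (swap_indet i v))"
  by (auto simp: swap_x_def subst_eq_ev swap_indet_def intro!: arg_cong[of _ _ ev] split: indet.splits)

lemma swap_x_hom: 
  "swap_x i (f + g) = swap_x i f + swap_x i g"
  "swap_x i (f * g) = swap_x i f * swap_x i g"
  "swap_x i (f - g) = swap_x i f - swap_x i g"
  "swap_x i (of_int n) = of_int n"
  "swap_x i (indet v) = indet (swap_indet i v)"
  by (simp_all add: swap_x_ev ev_add ev_mult ev_of_int ev_diff)

lemma xv_diff_nonzero: "xv i - xv (i + 1) \<noteq> 0"
  by (simp add: indet_inject)

lemma divided_difference_eqI:
  assumes "(xv i - xv (i + 1)) * g = f - swap_x i f"
  shows "divided_difference i f = g"
  unfolding divided_difference_def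
proof (rule the_equality)
  fix h assume "(xv i - xv (i + 1)) * h = f - swap_x i f"
  then show "h = g" using assms xv_diff_nonzero[of i] by (metis mult_cancel_left)
qed (rule assms)

lemma swap_indet_dvd: "(xv i - xv (i + 1)) dvd (indet v - indet (swap_indet i v))"
proof (cases "swap_indet i v = v")
  case False
  then have "v = X i \<or> v = X (i + 1)"
    by (auto simp: swap_indet_def transpose_def split: indet.splits if_splits)
  then show ?thesis
    by (auto simp: swap_indet_def intro: dvdI[of _ _ "-1"])
qed simp

lemma divided_difference_mult: "(xv i - xv (i + 1)) * divided_difference i f = f - swap_x i f"
proof -
  have "(xv i - xv (i + 1)) dvd (f - swap_x i f)"
    unfolding swap_x_ev by (rule ev_diff_dvd[OF swap_indet_dvd])
  then obtain g where "f - swap_x i f = (xv i - xv (i + 1)) * g" by (auto simp: dvd_def)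
  then show ?thesis using divided_difference_eqI[of i g f] by simp
qed

text \<open>An upper bound for the degree in the x-variables, the y-variables counting as scalars.
  The rules also exclude every \<open>C k\<close> and every \<open>X j\<close> with j < 1, see
  \<open>xdeg_gen\<close>.\<close>

inductive xdeg :: "nat \<Rightarrow> cxy_poly \<Rightarrow> bool" where
  xdeg_int: "xdeg d (of_int n)"
| xdeg_y: "xdeg d f \<Longrightarrow> xdeg d (yv j * f)"
| xdeg_x: "xdeg d f \<Longrightarrow> 1 \<le> j \<Longrightarrow> xdeg (Suc d) (xv j * f)"
| xdeg_add: "xdeg d f \<Longrightarrow> xdeg d g \<Longrightarrow> xdeg d (f + g)"

lemma xdeg_0: "xdeg d 0"
  using xdeg_int[of d 0] by simp

lemma xdeg_int_mult:
  assumes "xdeg d f"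
  shows "xdeg d (of_int n * f)"
  using assms
proof induction
  case (xdeg_int d k)
  then show ?case using xdeg.xdeg_int[of d "n * k"] by simp
next
  case (xdeg_y d f j)
  then show ?case using xdeg.xdeg_y[of d "of_int n * f" j] by (simp add: mult_ac)
next
  case (xdeg_x d f j)
  then show ?case using xdeg.xdeg_x[of d "of_int n * f" j] by (simp add: mult_ac)
next
  case (xdeg_add d f g)
  then show ?case by (simp add: distrib_left xdeg.xdeg_add)
qed

lemma xdeg_uminus: "xdeg d f \<Longrightarrow> xdeg d (- f)"
  using xdeg_int_mult[of d f "-1"] by simp

lemma xdeg_diff: "xdeg d f \<Longrightarrow> xdeg d g \<Longrightarrow> xdeg d (f - g)"
  using xdeg_add[of d f "- g"] xdeg_uminus by simp

lemma xdeg_Suc: "xdeg d f \<Longrightarrow> xdeg (Suc d) f"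
  by (induction rule: xdeg.induct) (auto intro: xdeg.intros)

lemma xdeg_linear_factor:
  assumes "xdeg d f" "1 \<le> i"
  shows "xdeg (Suc d) ((xv i - yv j) * f)"
  using assms by (simp add: left_diff_distrib xdeg_diff xdeg_x xdeg_y xdeg_Suc)

lemma xdeg_swap_x: "xdeg d f \<Longrightarrow> 1 \<le> i \<Longrightarrow> xdeg d (swap_x i f)"
proof (induction rule: xdeg.induct)
  case (xdeg_x d f j)
  have "1 \<le> transpose i (i + 1) j"
    using xdeg_x by (auto simp: transpose_def)
  then show ?case using xdeg_x
    by (simp add: swap_x_hom swap_indet_def xdeg.xdeg_x)
qed (auto simp: swap_x_hom swap_indet_def intro: xdeg.intros)

text \<open>With d_i the divided difference and s_i the exchange, the twisted Leibniz rule d_i(x_j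
  f) = x_j d_i(f) + d_i(x_j) s_i(f) gives the induction. The case split on \<open>d\<close> records
  that degree 0 forces d_i(f) = 0.\<close>

lemma xdeg_divided_difference_aux:
  assumes "xdeg d f" "1 \<le> i"
  shows "\<exists>g. (xv i - xv (i + 1)) * g = f - swap_x i f \<and>
           (case d of 0 \<Rightarrow> g = 0 | Suc e \<Rightarrow> xdeg e g)"
  using assms
proof (induction rule: xdeg.induct)
  case (xdeg_int d n)
  then show ?case by (intro exI[of _ 0]) (auto simp: swap_x_hom xdeg_0 split: nat.splits)
next
  case (xdeg_y d f j)
  then obtain g where g: "(xv i - xv (i + 1)) * g = f - swap_x i f"
    "case d of 0 \<Rightarrow> g = 0 | Suc e \<Rightarrow> xdeg e g" by blast
  have "(xv i - xv (i + 1)) * (yv j * g) = yv j * f - swap_x i (yv j * f)"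
    using arg_cong[OF g(1), of "\<lambda>z. yv j * z"]
    by (simp add: swap_x_hom swap_indet_def algebra_simps)
  then show ?case using g(2)
    by (intro exI[of _ "yv j * g"]) (auto simp: xdeg.xdeg_y split: nat.splits)
next
  case (xdeg_x d f j)
  then obtain g where g: "(xv i - xv (i + 1)) * g = f - swap_x i f"
    "case d of 0 \<Rightarrow> g = 0 | Suc e \<Rightarrow> xdeg e g" by blast
  \<comment> \<open>The divided difference of x_j, which is an integer.\<close>
  define n :: int where "n = (if j = i then 1 else if j = i + 1 then -1 else 0)"
  have n: "xv j - xv (transpose i (i + 1) j) = (xv i - xv (i + 1)) * of_int n"
    by (auto simp: n_def transpose_def)
  let ?h = "xv j * g + of_int n * swap_x i f"
  have "xv j * f - swap_x i (xv j * f) =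
        xv j * (f - swap_x i f) + (xv j - xv (transpose i (i + 1) j)) * swap_x i f"
    by (simp add: swap_x_hom swap_indet_def algebra_simps)
  also have "\<dots> = (xv i - xv (i + 1)) * ?h"
    unfolding n g(1)[symmetric] by (simp add: algebra_simps)
  finally have "(xv i - xv (i + 1)) * ?h = xv j * f - swap_x i (xv j * f)" by simp
  \<comment> \<open>For \<open>d = 0\<close> the induction hypothesis gives
    \<open>g = 0\<close>.\<close>
  moreover have "xdeg d (xv j * g)"
    using g(2) xdeg_x(2) by (cases d) (auto simp: xdeg_0 intro: xdeg.xdeg_x)
  then have "xdeg d ?h"
    using xdeg_x by (intro xdeg_add xdeg_int_mult xdeg_swap_x)
  ultimately show ?case by auto
next
  case (xdeg_add d f1 f2)
  then obtain g1 g2 where g: "(xv i - xv (i + 1)) * g1 = f1 - swap_x i f1"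
    "(xv i - xv (i + 1)) * g2 = f2 - swap_x i f2"
    "case d of 0 \<Rightarrow> g1 = 0 | Suc e \<Rightarrow> xdeg e g1"
    "case d of 0 \<Rightarrow> g2 = 0 | Suc e \<Rightarrow> xdeg e g2" by blast
  have "(xv i - xv (i + 1)) * (g1 + g2) = f1 + f2 - swap_x i (f1 + f2)"
    unfolding distrib_left g(1,2) by (simp add: swap_x_hom)
  then show ?case using g(3,4)
    by (intro exI[of _ "g1 + g2"]) (auto simp: xdeg.xdeg_add split: nat.splits)
qed

lemma xdeg_divided_difference: "xdeg (Suc d) f \<Longrightarrow> 1 \<le> i \<Longrightarrow> xdeg d (divided_difference i f)"
  using xdeg_divided_difference_aux[of "Suc d" f i] divided_difference_eqI by fastforce

lemma divided_difference_xdeg_0: "xdeg 0 f \<Longrightarrow> 1 \<le> i \<Longrightarrow> divided_difference i f = 0"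
  using xdeg_divided_difference_aux[of 0 f i] divided_difference_eqI by fastforce

lemma xdeg_gen: "xdeg d f \<Longrightarrow> f \<in> gen (X ` {1..} \<union> range Y)"
  by (induction rule: xdeg.induct) (auto intro: gen.intros)

section \<open>Polynomials symmetric in all x_i with i >= 1\<close>

lemma divided_difference_0_imp: "divided_difference i f = 0 \<Longrightarrow> swap_x i f = f"
  using divided_difference_mult[of i f] by simp

text \<open>Inserting \<open>y\<^sub>1\<close> at position \<open>i\<close> and at position \<open>i + 1\<close> of the sequence of the \<open>x\<^sub>j\<close>
  gives the same value at a polynomial symmetric in \<open>x\<^sub>i\<close> and \<open>x\<^sub>i\<^sub>+\<^sub>1\<close>; inserting it beyond all
  the variables that occur has no effect.\<close>

definition insert_y :: "int \<Rightarrow> indet \<Rightarrow> cxy_poly" where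
  "insert_y i v = (case v of X j \<Rightarrow> if j < i then xv j else if j = i then yv 1 else xv (j - 1)
     | _ \<Rightarrow> indet v)"

lemma insert_y_swap_x: "ev (insert_y (i + 1)) (swap_x i f) = ev (insert_y i) f"
proof -
  have *: "ev (insert_y (i + 1)) (indet (swap_indet i v)) = insert_y i v" for v
    by (auto simp: insert_y_def swap_indet_def transpose_def split: indet.splits)
  show ?thesis by (simp only: swap_x_ev ev_ev *)
qed

text \<open>By symmetry y_1 can be inserted at position 1 or beyond all variables of
  \<open>f\<close>. The latter leaves \<open>f\<close> unchanged, while the former leaves one
  x-variable fewer.\<close>

lemma symmetric_gen_y_aux:
  assumes "\<And>i. 1 \<le> i \<Longrightarrow> swap_x i f = f" "f \<in> gen (X ` {1..int M} \<union> range Y)"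
  shows "f \<in> gen (range Y)"
  using assms(2)
proof (induction M)
  case 0
  then show ?case by simp
next
  case (Suc M)
  have "ev (insert_y (1 + int k)) f = ev (insert_y 1) f" for k
  proof (induction k)
    case (Suc k)
    then show ?case
      using insert_y_swap_x[of "1 + int k" f] assms(1)[of "1 + int k"] by (simp add: add_ac)
  qed simp
  then have "ev (insert_y (1 + int (Suc M))) f = ev (insert_y 1) f" by blast
  moreover have "ev (insert_y (1 + int (Suc M))) f = f"
    by (rule ev_ident_gen[OF Suc.prems]) (auto simp: insert_y_def)
  moreover have "ev (insert_y 1) f \<in> gen (X ` {1..int M} \<union> range Y)"
    by (rule ev_gen[OF Suc.prems]) (auto simp: insert_y_def intro!: gen_indet)
  ultimately show ?case using Suc.IH by simp
qed

lemma symmetric_gen_y: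
  assumes "\<And>i. 1 \<le> i \<Longrightarrow> swap_x i f = f" "f \<in> gen (X ` {1..} \<union> range Y)"
  shows "f \<in> gen (range Y)"
proof -
  obtain B where B: "finite B" "B \<subseteq> X ` {1..} \<union> range Y" "f \<in> gen B"
    using gen_finite[OF assms(2)] by blast
  have "finite (X -` B)"
    by (rule finite_vimageI[OF B(1)]) (auto simp: inj_def)
  then obtain M where M: "\<And>i. i \<in> X -` B \<Longrightarrow> i \<le> M"
    by (meson bdd_above.E bdd_above_finite)
  have "B \<subseteq> X ` {1..int (nat M)} \<union> range Y"
  proof
    fix v assume v: "v \<in> B"
    show "v \<in> X ` {1..int (nat M)} \<union> range Y"
      using v B(2) M[of "case v of X i \<Rightarrow> i"] by (auto intro!: imageI)
  qed
  then show ?thesis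
    using symmetric_gen_y_aux[OF assms(1)] gen_mono[OF B(3)] by blast
qed

subsection \<open>Inversions\<close>

text \<open>Inversions are recorded by values rather than positions because localization at
  \<open>w\<close> produces factors y_a - y_b indexed by values.\<close>

definition inversions :: "(int \<Rightarrow> int) \<Rightarrow> (int \<times> int) set" where
  "inversions w = {(a, b). b < a \<and> inv w a < inv w b}"

abbreviation perm_length :: "(int \<Rightarrow> int) \<Rightarrow> nat" where
  "perm_length w \<equiv> card (inversions w)"

lemma S_Z_bij: "w \<in> S_Z \<Longrightarrow> bij w" and S_plus_S_Z: "w \<in> S_plus \<Longrightarrow> w \<in> S_Z"
  by (auto simp: S_Z_def S_plus_def)

lemma S_plus_bij: "w \<in> S_plus \<Longrightarrow> bij w"
  by (simp add: S_Z_bij S_plus_S_Z)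

lemma S_Z_bounded:
  assumes "w \<in> S_Z"
  obtains n where "\<And>i. i < -n \<Longrightarrow> w i = i" "\<And>i. i > n \<Longrightarrow> w i = i"
proof -
  have fin: "finite {i. w i \<noteq> i}" using assms by (simp add: S_Z_def)
  then obtain n where n: "\<forall>i\<in>abs ` {i. w i \<noteq> i}. i \<le> n"
    by (meson bdd_above.E bdd_above_finite finite_imageI)
  show thesis
    by (rule that[of n]) (use n in force)+
qed

lemma inv_fixed: "bij w \<Longrightarrow> w i = i \<Longrightarrow> inv w i = i"
  by (metis bij_inv_eq_iff)

lemma fixed_outside_range:
  assumes "bij w" "\<And>i. i < a \<or> i > b \<Longrightarrow> w i = (i::int)" "a \<le> i" "i \<le> b"
  shows "a \<le> w i" "w i \<le> b"
proof -
  have "w (w i) = w i \<Longrightarrow> w i = i" using assms(1) by (metis bij_def injD)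
  then show "a \<le> w i" "w i \<le> b" using assms(2)[of "w i"] assms(3,4) by force+
qed

lemma inversions_subset:
  assumes w: "bij w" "\<And>i. i < a \<or> i > b \<Longrightarrow> w i = i"
  shows "inversions w \<subseteq> {(x, y). a \<le> y \<and> y < x \<and> x \<le> b}"
proof clarsimp
  fix x y assume "(x, y) \<in> inversions w"
  then have xy: "y < x" "inv w x < inv w y" by (auto simp: inversions_def)
  have fix': "i < a \<or> i > b \<Longrightarrow> inv w i = i" for i using w by (simp add: inv_fixed)
  have rng: "a \<le> inv w i" "inv w i \<le> b" if "a \<le> i" "i \<le> b" for i
    using fixed_outside_range[of "inv w" a b i] fix' that w(1) by (auto simp: bij_imp_bij_inv)
  show "a \<le> y \<and> y < x \<and> x \<le> b"
    using xy fix'[of x] fix'[of y] rng[of x] rng[of y] by linarith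
qed

lemma finite_box: "finite {(x, y). (a::int) \<le> y \<and> y < x \<and> x \<le> b}"
  by (rule finite_subset[of _ "{a..b} \<times> {a..b}"]) auto

lemma finite_inversions: "w \<in> S_Z \<Longrightarrow> finite (inversions w)"
proof -
  assume w: "w \<in> S_Z"
  then obtain n where "\<And>i. i < -n \<Longrightarrow> w i = i" "\<And>i. i > n \<Longrightarrow> w i = i"
    using S_Z_bounded by blast
  then have "inversions w \<subseteq> {(x, y). -n \<le> y \<and> y < x \<and> x \<le> n}"
    using S_Z_bij[OF w] by (intro inversions_subset) auto
  then show ?thesis using finite_box by (rule finite_subset)
qed

lemma S_Z_swap:
  assumes "w \<in> S_Z" shows "w \<circ> transpose i (i + 1) \<in> S_Z"
proof -
  have "bij (w \<circ> transpose i (i + 1))"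
    using assms by (simp add: S_Z_bij bij_comp)
  moreover have "{j. (w \<circ> transpose i (i + 1)) j \<noteq> j} \<subseteq> insert i (insert (i + 1) {j. w j \<noteq> j})"
    by (auto simp: transpose_def)
  ultimately show ?thesis using assms
    by (auto simp: S_Z_def intro: finite_subset)
qed

lemma S_plus_swap: "w \<in> S_plus \<Longrightarrow> 1 \<le> i \<Longrightarrow> w \<circ> transpose i (i + 1) \<in> S_plus"
  using S_Z_swap[of w i] by (auto simp: S_plus_def transpose_def)

lemma swap_swap: "w \<circ> transpose i j \<circ> transpose i j = w"
  by (simp add: o_assoc[symmetric])

text \<open>Exchanging the entries in adjacent positions changes the relative order of these two
  entries only.\<close>

lemma inversions_swap:
  assumes "bij w" "w i > w (i + 1)"
  shows "inversions w = insert (w i, w (i + 1)) (inversions (w \<circ> transpose i (i + 1)))"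
    and "(w i, w (i + 1)) \<notin> inversions (w \<circ> transpose i (i + 1))"
proof -
  have inv': "inv (w \<circ> transpose i (i + 1)) = transpose i (i + 1) \<circ> inv w"
    using assms by (simp add: o_inv_distrib)
  have invw: "inv w (w j) = j" for j using assms by (simp add: bij_is_inj)
  show "(w i, w (i + 1)) \<notin> inversions (w \<circ> transpose i (i + 1))"
    by (simp add: inversions_def inv' invw)
  have "(a, b) \<in> inversions w \<longleftrightarrow> (a, b) = (w i, w (i + 1)) \<or> (a, b) \<in> inversions (w \<circ> transpose i (i + 1))"
    for a b
  proof -
    obtain p q where pq: "a = w p" "b = w q" using assms(1) by (metis bij_pointE)
    have "p < q \<longleftrightarrow> transpose i (i + 1) p < transpose i (i + 1) q" if "\<not> (p = i \<and> q = i + 1)" "\<not> (p = i + 1 \<and> q = i)"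
      using that by (auto simp: transpose_def)
    moreover have "w p = w i \<longleftrightarrow> p = i" "w q = w (i + 1) \<longleftrightarrow> q = i + 1"
      using assms(1) by (auto simp: bij_def inj_eq)
    moreover have "\<not> (p = i + 1 \<and> q = i \<and> b < a)"
      using assms(2) pq by auto
    ultimately show ?thesis using assms(2)
      by (cases "p = i \<and> q = i + 1"; cases "p = i + 1 \<and> q = i")
         (auto simp: inversions_def inv' pq invw)
  qed
  then show "inversions w = insert (w i, w (i + 1)) (inversions (w \<circ> transpose i (i + 1)))"
    by auto
qed

lemma perm_length_swap:
  assumes "w \<in> S_Z" "w i > w (i + 1)"
  shows "perm_length w = Suc (perm_length (w \<circ> transpose i (i + 1)))"
  using inversions_swap[OF S_Z_bij assms(2)] finite_inversions[OF S_Z_swap, of w i] assms(1)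
  by simp

lemma perm_length_swap_le:
  assumes "w \<in> S_Z"
  shows "perm_length (w \<circ> transpose i (i + 1)) \<le> Suc (perm_length w)"
proof -
  have "w i \<noteq> w (i + 1)" using S_Z_bij[OF assms] by (metis bij_def injD add_cancel_right_right zero_neq_one)
  then consider "w i > w (i + 1)" | "w i < w (i + 1)" by linarith
  then show ?thesis
  proof cases
    case 1
    then show ?thesis using perm_length_swap[OF assms] by simp
  next
    case 2
    then show ?thesis
      using perm_length_swap[OF S_Z_swap[OF assms, of i], of i] by (simp add: swap_swap)
  qed
qed

subsection \<open>Localization of double Schubert polynomials\<close>

definition localize :: "(int \<Rightarrow> int) \<Rightarrow> cxy_poly \<Rightarrow> cxy_poly" where
  "localize v = ev (\<lambda>u. case u of X i \<Rightarrow> yv (v i) | _ \<Rightarrow> indet u)"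

lemma localize_simps [simp]:
  "localize v (xv i) = yv (v i)" "localize v (yv j) = yv j"
  "localize v (f - g) = localize v f - localize v g"
  "localize v (f * g) = localize v f * localize v g"
  by (simp_all add: localize_def ev_diff ev_mult)

lemma localize_swap_x: "localize v (swap_x i f) = localize (v \<circ> transpose i (i + 1)) f"
  by (auto simp: localize_def swap_x_ev ev_ev swap_indet_def intro!: arg_cong2[of _ _ _ _ ev] split: indet.splits)

lemma localize_gen_y: "f \<in> gen (range Y) \<Longrightarrow> localize v f = f"
  unfolding localize_def by (rule ev_ident_gen) auto

text \<open>Exchanging x_i and x_(i+1) before localizing at \<open>v\<close> amounts to localizing
  at v s_i.\<close>

lemma localize_divided_difference:
  "(yv (v i) - yv (v (i + 1))) * localize v (divided_difference i f) =
   localize v f - localize (v \<circ> transpose i (i + 1)) f"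
  using arg_cong[OF divided_difference_mult[of i f], of "localize v"]
  by (simp add: localize_swap_x)

text \<open>Each divided difference of \<open>f\<close> satisfies the hypotheses for d - 1, since v
  s_i is at most one longer than \<open>v\<close>, and so vanishes by induction. Then
  \<open>f\<close> is symmetric in all x_i, hence a polynomial in the y_j alone, and equals its
  localization at \<open>id\<close>.\<close>

lemma localize_vanishing_imp_0:
  assumes "xdeg d f" "\<And>v. v \<in> S_plus \<Longrightarrow> perm_length v \<le> d \<Longrightarrow> localize v f = 0"
  shows "f = 0"
  using assms
proof (induction d arbitrary: f)
  have *: "f = 0" if "\<And>i. 1 \<le> i \<Longrightarrow> divided_difference i f = 0" "xdeg d f"
    "\<And>v. v \<in> S_plus \<Longrightarrow> perm_length v \<le> d \<Longrightarrow> localize v f = 0" for f d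
  proof -
    have "f \<in> gen (range Y)"
      using that(1) divided_difference_0_imp xdeg_gen[OF that(2)] by (intro symmetric_gen_y) auto
    moreover have "id \<in> S_plus" "inversions id = {}"
      by (auto simp: S_plus_def S_Z_def inversions_def)
    ultimately show "f = 0" using that(3)[of id] localize_gen_y[of f id] by simp
  qed
  {
    case 0
    then show ?case using * divided_difference_xdeg_0 by blast
  next
    case (Suc d)
    show ?case
    proof (rule *[OF _ Suc.prems])
      fix i :: int assume i: "1 \<le> i"
      show "divided_difference i f = 0"
      proof (rule Suc.IH)
        show "xdeg d (divided_difference i f)" using Suc.prems i by (simp add: xdeg_divided_difference)
        fix v assume v: "v \<in> S_plus" "perm_length v \<le> d"
        have "perm_length (v \<circ> transpose i (i + 1)) \<le> Suc d"
          using v perm_length_swap_le[OF S_plus_S_Z, of v i] by linarith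
        then have "localize (v \<circ> transpose i (i + 1)) f = 0"
          using v i by (intro Suc.prems S_plus_swap)
        moreover have "localize v f = 0" using v by (intro Suc.prems) auto
        ultimately have "(yv (v i) - yv (v (i + 1))) * localize v (divided_difference i f) = 0"
          by (simp add: localize_divided_difference)
        moreover have "v i \<noteq> v (i + 1)"
          using S_plus_bij[OF v(1)] by (metis bij_def injD add_cancel_right_right zero_neq_one)
        ultimately show "localize v (divided_difference i f) = 0"
          by (simp add: indet_inject)
      qed
    qed
  }
qed

text \<open>No reduced words are involved, so neither the braid relations nor stability is needed to see
  that double Schubert polynomials are well defined.\<close>

definition schubert_class :: "(int \<Rightarrow> int) \<Rightarrow> cxy_poly \<Rightarrow> bool" where
  "schubert_class w f \<longleftrightarrow> w \<in> S_plus \<and> xdeg (perm_length w) f \<and>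
     (\<forall>v\<in>S_plus. perm_length v \<le> perm_length w \<longrightarrow>
        localize v f = (if v = w then \<Prod>(a, b)\<in>inversions w. yv a - yv b else 0))"

lemma schubert_class_unique:
  assumes "schubert_class w f" "schubert_class w g"
  shows "f = g"
proof -
  have "f - g = 0"
    by (rule localize_vanishing_imp_0[of "perm_length w"])
       (use assms in \<open>auto simp: schubert_class_def xdeg_diff\<close>)
  then show ?thesis by simp
qed

text \<open>Let u = w s_i. If \<open>v\<close> is no longer than u, then it is shorter than
  \<open>w\<close>, so \<open>f\<close> vanishes at \<open>v\<close>, and also at v s_i unless v =
  u. For v = u the denominator cancels the factor of the one inversion that is lost.\<close>

lemma schubert_class_divided_difference:
  assumes w: "schubert_class w f" and i: "1 \<le> i" "w i > w (i + 1)"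
  shows "schubert_class (w \<circ> transpose i (i + 1)) (divided_difference i f)"
proof -
  let ?u = "w \<circ> transpose i (i + 1)"
  have wS: "w \<in> S_plus" using w by (simp add: schubert_class_def)
  have len: "perm_length w = Suc (perm_length ?u)"
    by (rule perm_length_swap[OF S_plus_S_Z[OF wS] i(2)])
  note inv = inversions_swap[OF S_plus_bij[OF wS] i(2)]
  have fin: "finite (inversions ?u)"
    using wS by (intro finite_inversions S_Z_swap S_plus_S_Z)
  have "localize v (divided_difference i f) =
      (if v = ?u then \<Prod>(a, b)\<in>inversions ?u. yv a - yv b else 0)"
    if v: "v \<in> S_plus" "perm_length v \<le> perm_length ?u" for v
  proof -
    have ne: "v i \<noteq> v (i + 1)"
      using S_plus_bij[OF v(1)] by (metis bij_def injD add_cancel_right_right zero_neq_one)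
    have "v \<noteq> w" using v len by auto
    then have "localize v f = 0" using w v len by (auto simp: schubert_class_def)
    moreover have "v \<circ> transpose i (i + 1) = w \<longleftrightarrow> v = ?u"
      by (metis swap_swap)
    moreover have "v \<circ> transpose i (i + 1) \<in> S_plus" "perm_length (v \<circ> transpose i (i + 1)) \<le> perm_length w"
      using v i S_plus_swap perm_length_swap_le[OF S_plus_S_Z, of v i] len by auto
    ultimately have *: "(yv (v i) - yv (v (i + 1))) * localize v (divided_difference i f) =
        (if v = ?u then - (\<Prod>(a, b)\<in>inversions w. yv a - yv b) else 0)"
      using w unfolding localize_divided_difference by (auto simp: schubert_class_def)
    show ?thesis
    proof (cases "v = ?u")
      case True
      \<comment> \<open>For v = w s_i the difference y_(v(i)) - y_(v(i+1)) is minus the factor of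
        the lost inversion, which absorbs the sign.\<close>
      have "(yv (v i) - yv (v (i + 1))) * localize v (divided_difference i f) =
        (yv (v i) - yv (v (i + 1))) * (\<Prod>(a, b)\<in>inversions ?u. yv a - yv b)"
        unfolding * using True inv fin by (simp add: algebra_simps)
      then show ?thesis using ne True by (simp add: indet_inject)
    next
      case False
      then show ?thesis using * ne by (simp add: indet_inject)
    qed
  qed
  then show ?thesis
    using w i len S_plus_swap[OF wS] by (auto simp: schubert_class_def xdeg_divided_difference)
qed

subsection \<open>Dominant permutations\<close>

text \<open>The Rothe diagram: rows are positions, columns are values.\<close>

definition rothe :: "(int \<Rightarrow> int) \<Rightarrow> (int \<times> int) set" where
  "rothe w = {(i, k). k < w i \<and> i < inv w k}"

lemma rothe_inversions:
  assumes "bij w"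
  shows "bij_betw (\<lambda>(i, k). (w i, k)) (rothe w) (inversions w)"
proof -
  have "inv w (w i) = i" "w (inv w i) = i" for i
    using assms by (simp_all add: bij_is_inj bij_is_surj surj_f_inv_f)
  then show ?thesis
    by (intro bij_betwI[where g = "\<lambda>(a, b). (inv w a, b)"]) (auto simp: rothe_def inversions_def)
qed

text \<open>At the first position i where they differ, say v(i) < w(i), the value v(i) stands to the
  right of i in \<open>w\<close>. So the box (i, v(i)) lies in the diagram of \<open>w\<close> but
  not in that of \<open>v\<close>.\<close>

lemma rothe_inject:
  assumes "v \<in> S_plus" "w \<in> S_plus" "rothe v = rothe w"
  shows "v = w"
proof
  have main: "\<not> v i < w i" if "v \<in> S_plus" "w \<in> S_plus" "rothe v = rothe w" "\<And>j. j < i \<Longrightarrow> v j = w j" for v w i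
  proof
    assume lt: "v i < w i"
    have inj: "inj v" "inj w" "w (inv w j) = j" for j
      using that S_plus_bij by (auto simp: bij_def surj_f_inv_f)
    have "\<not> inv w (v i) < i"
    proof
      assume "inv w (v i) < i"
      moreover from this have "v (inv w (v i)) = v i" using that(4) inj by simp
      ultimately show False using inj(1) by (metis injD less_irrefl)
    qed
    moreover have "inv w (v i) \<noteq> i" using lt inj(3)[of "v i"] by auto
    ultimately have "(i, v i) \<in> rothe w" using lt by (auto simp: rothe_def)
    then show False using that(3) by (auto simp: rothe_def set_eq_iff)
  qed
  fix i
  show "v i = w i"
  proof (induction "nat i" arbitrary: i rule: less_induct)
    case less
    show ?case
    proof (cases "i \<le> 0")
      case True
      then show ?thesis using assms by (simp add: S_plus_def)
    next
      case False
      have "v j = w j" if "j < i" for j using less[of j] that False by simp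
      then show ?thesis
        using main[OF assms, of i] main[OF assms(2,1) assms(3)[symmetric], of i] by force
    qed
  qed
qed

lemma xdeg_linear_product:
  assumes "finite D" "\<And>i j. (i, j) \<in> D \<Longrightarrow> 1 \<le> i"
  shows "xdeg (card D) (\<Prod>(i, j)\<in>D. xv i - yv j)"
  using assms
proof (induction D)
  case empty
  then show ?case using xdeg_int[of 0 1] by simp
next
  case (insert p D)
  have "xdeg (card D) (\<Prod>(i, j)\<in>D. xv i - yv j)" using insert by blast
  then show ?case using insert(1,2) insert.prems[of "fst p" "snd p"]
    by (cases p) (simp add: xdeg_linear_factor)
qed

lemma S_plus_pos: "v \<in> S_plus \<Longrightarrow> 1 \<le> i \<Longrightarrow> 1 \<le> v i"
  and S_plus_inv_pos: "v \<in> S_plus \<Longrightarrow> 1 \<le> i \<Longrightarrow> 1 \<le> inv v i"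
proof -
  have *: "1 \<le> v i" if "bij v" "\<And>i. i \<le> 0 \<Longrightarrow> v i = i" "1 \<le> i" for v and i :: int
  proof (rule ccontr)
    assume "\<not> 1 \<le> v i"
    then have "v (v i) = v i" using that(2)[of "v i"] by simp
    then have "v i = i" using that(1) by (metis bij_def injD)
    then show False using that \<open>\<not> 1 \<le> v i\<close> by simp
  qed
  show "v \<in> S_plus \<Longrightarrow> 1 \<le> i \<Longrightarrow> 1 \<le> v i"
    using * by (auto simp: S_plus_def S_Z_def)
  show "v \<in> S_plus \<Longrightarrow> 1 \<le> i \<Longrightarrow> 1 \<le> inv v i"
    using *[of "inv v" i] by (auto simp: S_plus_def S_Z_def bij_imp_bij_inv inv_fixed)
qed

text \<open>\<open>lower\<close> makes \<open>D\<close> a Young diagram. If the localization at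
  \<open>v\<close> is nonzero, no (i, v(i)) lies in \<open>D\<close>, and downward closure then puts
  \<open>D\<close> inside \<open>rothe v\<close>. The length bound forces equality, and the diagram
  determines the permutation.\<close>

lemma schubert_class_dominant:
  assumes w: "w \<in> S_plus" "rothe w = D"
    and pos: "\<And>i j. (i, j) \<in> D \<Longrightarrow> 1 \<le> i \<and> 1 \<le> j"
    and lower: "\<And>i j i' j'. (i, j) \<in> D \<Longrightarrow> 1 \<le> i' \<Longrightarrow> i' \<le> i \<Longrightarrow> 1 \<le> j' \<Longrightarrow> j' \<le> j \<Longrightarrow> (i', j') \<in> D"
  shows "schubert_class w (\<Prod>(i, j)\<in>D. xv i - yv j)"
proof -
  let ?f = "\<Prod>(i, j)\<in>D. xv i - yv j"
  have finr: "finite (rothe v)" "perm_length v = card (rothe v)" if "v \<in> S_plus" for v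
    using rothe_inversions[OF S_plus_bij[OF that]] finite_inversions[OF S_plus_S_Z[OF that]]
    by (auto simp: bij_betw_finite bij_betw_same_card)
  have fin: "finite D" "card D = perm_length w" using finr[OF w(1)] w(2) by auto
  have loc: "localize v ?f = (\<Prod>(i, j)\<in>D. yv (v i) - yv j)" for v
    unfolding localize_def ev_prod by (rule prod.cong) (auto simp: ev_diff)
  have "localize w ?f = (\<Prod>(a, b)\<in>inversions w. yv a - yv b)"
    unfolding loc using w(2) prod.reindex_bij_betw[OF rothe_inversions[OF S_plus_bij[OF w(1)]], of "\<lambda>(a, b). yv a - yv b"]
    by (simp add: case_prod_beta)
  moreover have "v = w" if v: "v \<in> S_plus" "perm_length v \<le> perm_length w" "localize v ?f \<noteq> 0" for v
  proof -
    have notin: "(i, v i) \<notin> D" for i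
    proof
      assume "(i, v i) \<in> D"
      then have "localize v ?f = 0" unfolding loc using fin
        by (intro prod_zero bexI[of _ "(i, v i)"]) auto
      then show False using v(3) by contradiction
    qed
    have "D \<subseteq> rothe v"
    proof clarify
      fix i k assume ik: "(i, k) \<in> D"
      have "\<not> v i \<le> k"
        using notin[of i] lower[OF ik, of i "v i"] pos[OF ik] S_plus_pos[OF v(1), of i] by auto
      moreover have "\<not> inv v k \<le> i"
        using notin[of "inv v k"] lower[OF ik, of "inv v k" k] pos[OF ik] S_plus_inv_pos[OF v(1), of k]
          S_plus_bij[OF v(1)] by (auto simp: bij_is_surj surj_f_inv_f)
      ultimately show "(i, k) \<in> rothe v" by (simp add: rothe_def)
    qed
    then have "rothe v = D" using v finr fin by (metis card_seteq)
    then show "v = w" using rothe_inject v(1) w by blast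
  qed
  ultimately show ?thesis
    using w fin xdeg_linear_product[of D] pos by (auto simp: schubert_class_def)
qed

subsection \<open>Descent from the longest permutation\<close>

definition reversal :: "int \<Rightarrow> int \<Rightarrow> int \<Rightarrow> int" where
  "reversal a b i = (if a \<le> i \<and> i \<le> b then a + b - i else i)"

lemma bij_reversal: "bij (reversal a b)" and inv_reversal: "inv (reversal a b) = reversal a b"
proof -
  have "reversal a b \<circ> reversal a b = id" by (auto simp: reversal_def)
  then show "bij (reversal a b)" "inv (reversal a b) = reversal a b"
    by (auto intro: o_bij inv_unique_comp)
qed

text \<open>Each step to the right lowers the value by at least 1 while all values stay in the
  interval, which leaves no slack.\<close>

lemma decreasing_eq_reversal:
  assumes w: "bij w" "\<And>i. i < a \<or> i > b \<Longrightarrow> w i = i"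
    and dec: "\<And>i. a \<le> i \<Longrightarrow> i < b \<Longrightarrow> w (i + 1) < w i"
  shows "w = reversal a b"
proof
  have step: "w (i + int k) + int k \<le> w i" if "a \<le> i" "i + int k \<le> b" for i k
    using that
  proof (induction k)
    case (Suc k)
    then show ?case using dec[of "i + int k"] by (simp add: add_ac)
  qed simp
  fix i
  show "w i = reversal a b i"
  proof (cases "a \<le> i \<and> i \<le> b")
    case True
    have "w b + (b - i) \<le> w i" "w i + (i - a) \<le> w a"
      using step[of i "nat (b - i)"] step[of a "nat (i - a)"] True by simp_all
    moreover have "a \<le> w b" "w a \<le> b"
      using fixed_outside_range[OF w] True by auto
    ultimately show ?thesis using True by (simp add: reversal_def)
  next
    case False
    then show ?thesis using w(2)[of i] by (auto simp: reversal_def)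
  qed
qed

text \<open>Exchanging ascents as long as there are any leads up to the reversal; read backwards,
  this is a chain of descents. The induction is on the number of pairs not inverted.\<close>

lemma reversal_induct [consumes 2, case_names reversal descent]:
  assumes w: "bij w" "\<And>i. i < a \<or> i > b \<Longrightarrow> w i = i"
    and rev: "P (reversal a b)"
    and step: "\<And>w i. bij w \<Longrightarrow> (\<And>i. i < a \<or> i > b \<Longrightarrow> w i = i) \<Longrightarrow> a \<le> i \<Longrightarrow> i < b \<Longrightarrow>
        w i > w (i + 1) \<Longrightarrow> P w \<Longrightarrow> P (w \<circ> transpose i (i + 1))"
  shows "P w"
  using w
proof (induction "card {(x, y). a \<le> y \<and> y < x \<and> x \<le> b} - perm_length w" arbitrary: w rule: less_induct)
  case less
  let ?B = "{(x, y). a \<le> y \<and> y < x \<and> x \<le> b}"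
  show ?case
  proof (cases "\<exists>i. a \<le> i \<and> i < b \<and> w i < w (i + 1)")
    case True
    then obtain i where i: "a \<le> i" "i < b" "w i < w (i + 1)" by blast
    let ?u = "w \<circ> transpose i (i + 1)"
    have u: "bij ?u" "\<And>j. j < a \<or> j > b \<Longrightarrow> ?u j = j" "?u i > ?u (i + 1)"
      using less.prems i by (auto simp: bij_comp transpose_def)
    have "finite {j. w j \<noteq> j}"
      by (rule finite_subset[of _ "{a..b}"]) (use less.prems in force)+
    then have wS: "w \<in> S_Z" using less.prems by (simp add: S_Z_def)
    have "perm_length ?u = Suc (perm_length w)"
      using perm_length_swap[OF S_Z_swap[OF wS] u(3)] unfolding swap_swap .
    moreover have "perm_length ?u \<le> card ?B"
      by (rule card_mono[OF finite_box inversions_subset]) (use u in auto)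
    ultimately have "P ?u"
      using u by (intro less.hyps) auto
    from step[OF u(1,2) i(1,2) u(3) this] show ?thesis by (simp add: swap_swap)
  next
    case False
    have dec: "w (i + 1) < w i" if "a \<le> i" "i < b" for i
    proof -
      have "w i \<noteq> w (i + 1)"
        using less.prems(1) by (metis bij_def injD add_cancel_right_right zero_neq_one)
      then show ?thesis using False that by force
    qed
    have "w = reversal a b"
      by (rule decreasing_eq_reversal[OF less.prems dec])
    then show ?thesis using rev by (simp only:)
  qed
qed

section \<open>Well-definedness of double Schubert polynomials\<close>

lemma longest_perm_reversal: "longest_perm n = reversal 1 n"
  by (auto simp: longest_perm_def reversal_def)

lemma is_double_schubert_class: "is_double_schubert w f \<Longrightarrow> schubert_class w f"
proof (induction rule: is_double_schubert.induct)
  case (longest n)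
  let ?D = "{(i, j). 1 \<le> i \<and> 1 \<le> j \<and> i + j \<le> n}"
  have "finite {i. longest_perm n i \<noteq> i}"
    by (rule finite_subset[of _ "{1..n}"]) (auto simp: longest_perm_def)
  then have "longest_perm n \<in> S_plus"
    using bij_reversal[of 1 n] by (auto simp: S_plus_def S_Z_def longest_perm_reversal) (auto simp: reversal_def)
  moreover have "rothe (longest_perm n) = ?D"
  proof -
    have "(i, k) \<in> rothe (longest_perm n) \<longleftrightarrow> (i, k) \<in> ?D" for i k
      unfolding longest_perm_reversal rothe_def inv_reversal reversal_def
      by (cases "1 \<le> i \<and> i \<le> n"; cases "1 \<le> k \<and> k \<le> n") auto
    then show ?thesis by auto
  qed
  ultimately show ?case
    by (rule schubert_class_dominant) auto
next
  case (descent w f i)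
  then show ?case by (intro schubert_class_divided_difference)
qed

text \<open>Discharges the definite description: a derivation exists by descent from a longest
  permutation, and localization makes its result unique.\<close>

lemma schubert_class_double_schubert:
  assumes "w \<in> S_plus"
  shows "schubert_class w (double_schubert w)"
proof -
  obtain n where n: "\<And>i. i > n \<Longrightarrow> w i = i"
    using S_Z_bounded[OF S_plus_S_Z[OF assms]] by blast
  \<comment> \<open>The bound \<open>n\<close> may be below 1, where the rule \<open>longest\<close>
    does not apply.\<close>
  let ?n = "max 1 n"
  have "\<exists>f. is_double_schubert w f"
  proof (rule reversal_induct[where a = 1 and b = ?n and w = w])
    show "bij w" "\<And>i. i < 1 \<or> ?n < i \<Longrightarrow> w i = i"
      using assms n by (auto simp: S_plus_def S_Z_def)
    show "\<exists>f. is_double_schubert (reversal 1 ?n) f"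
      unfolding longest_perm_reversal[symmetric] by (rule exI, rule is_double_schubert.longest) simp
  qed (blast intro: is_double_schubert.descent)
  then obtain f where f: "is_double_schubert w f" by blast
  have "double_schubert w = f"
    unfolding double_schubert_def
    using f is_double_schubert_class schubert_class_unique by blast
  then show ?thesis using f is_double_schubert_class by simp
qed

lemma double_schubert_eqI: "schubert_class w f \<Longrightarrow> double_schubert w = f"
  using schubert_class_double_schubert schubert_class_unique schubert_class_def by blast

lemma double_schubert_swap:
  assumes "w \<in> S_plus" "1 \<le> i" "w i > w (i + 1)"
  shows "double_schubert (w \<circ> transpose i (i + 1)) = divided_difference i (double_schubert w)"
  using assms
  by (intro double_schubert_eqI schubert_class_divided_difference schubert_class_double_schubert)

subsection \<open>Power series with polynomial coefficients\<close>

abbreviation lin :: "'a::comm_ring_1 \<Rightarrow> 'a fps" where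
  "lin c \<equiv> 1 - fps_const c * fps_X"

text \<open>The series 1/(1 - ct), given by its coefficients so that ring homomorphisms visibly act
  on it.\<close>

definition geom :: "'a::comm_ring_1 \<Rightarrow> 'a fps" where
  "geom c = Abs_fps (\<lambda>n. c ^ n)"

lemma lin_nth_mult: "fps_nth (lin c * f) n = fps_nth f n - (if n = 0 then 0 else c * fps_nth f (n - 1))"
  by (simp add: left_diff_distrib mult.assoc)

lemma lin_geom: "lin c * geom c = 1"
proof (rule fps_ext)
  fix n show "fps_nth (lin c * geom c) n = fps_nth 1 n"
    unfolding lin_nth_mult by (cases n) (simp_all add: geom_def)
qed

lemma geom_lin: "geom c * lin c = 1"
  using lin_geom[of c] by (simp only: mult.commute)

text \<open>The divided difference of 1/(1 - at) is t/((1 - at)(1 - bt)): one more denominator and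
  one power of t. This drives the recursion for the determinants.\<close>

lemma geom_diff: "geom a - geom b = fps_const (a - b) * fps_X * geom a * geom b"
proof -
  have "geom a - geom b = geom a * (lin b * geom b) - geom b * (lin a * geom a)"
    by (simp only: lin_geom mult_1_right)
  also have "\<dots> = (fps_const a - fps_const b) * fps_X * geom a * geom b"
    by (simp add: algebra_simps del: fps_const_sub)
  finally show ?thesis by (simp only: fps_const_sub)
qed

definition ev_fps :: "(indet \<Rightarrow> 'a::comm_ring_1) \<Rightarrow> cxy_poly fps \<Rightarrow> 'a fps" where
  "ev_fps \<rho> f = Abs_fps (\<lambda>n. ev \<rho> (fps_nth f n))"

lemma ev_fps_nth [simp]: "fps_nth (ev_fps \<rho> f) n = ev \<rho> (fps_nth f n)"
  by (simp add: ev_fps_def)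

lemma ev_fps_mult: "ev_fps \<rho> (f * g) = ev_fps \<rho> f * ev_fps \<rho> g"
  by (rule fps_ext) (simp add: fps_mult_nth ev.hom_sum ev_mult)

lemma ev_fps_1 [simp]: "ev_fps \<rho> 1 = 1"
  by (rule fps_ext) simp

lemma ev_fps_prod: "ev_fps \<rho> (\<Prod>i\<in>A. f i) = (\<Prod>i\<in>A. ev_fps \<rho> (f i))"
  by (induction A rule: infinite_finite_induct) (simp_all add: ev_fps_mult)

lemma ev_fps_lin [simp]: "ev_fps \<rho> (lin c) = lin (ev \<rho> c)"
  by (rule fps_ext) (simp add: ev_diff ev_mult)

lemma ev_fps_geom [simp]: "ev_fps \<rho> (geom c) = geom (ev \<rho> c)"
  by (rule fps_ext) (simp add: geom_def ev.hom_power)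

text \<open>Determinant entries can have negative index and are then 0, as for complete symmetric
  polynomials.\<close>

definition icoeff :: "'a::comm_ring_1 fps \<Rightarrow> int \<Rightarrow> 'a" where
  "icoeff f z = (if z < 0 then 0 else fps_nth f (nat z))"

lemma icoeff_of_nat [simp]: "icoeff f (int n) = fps_nth f n"
  by (simp add: icoeff_def)

lemma ev_icoeff: "ev \<rho> (icoeff f z) = icoeff (ev_fps \<rho> f) z"
  by (simp add: icoeff_def)

lemma icoeff_diff: "icoeff (f - g) z = icoeff f z - icoeff g z"
  by (simp add: icoeff_def)

lemma icoeff_const_X_mult: "icoeff (fps_const c * fps_X * f) z = c * icoeff f (z - 1)"
  by (cases "z = 0") (auto simp: icoeff_def mult.assoc nat_diff_distrib)

text \<open>The bound frees the range of summation from \<open>z\<close>, so that such a coefficient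
  can be read as an entry of a matrix product.\<close>

lemma icoeff_mult_bounded:
  assumes "\<And>j. j > m \<Longrightarrow> fps_nth g j = 0"
  shows "icoeff (f * g) z = (\<Sum>j\<le>m. icoeff f (z - int j) * fps_nth g j)"
proof (cases "z < 0")
  case True
  then show ?thesis by (simp add: icoeff_def)
next
  case False
  then obtain n where z: "z = int n" by (metis nonneg_int_cases not_less)
  have "icoeff (f * g) z = (\<Sum>j=0..n. fps_nth g j * fps_nth f (n - j))"
    unfolding z by (simp only: icoeff_of_nat mult.commute[of f] fps_mult_nth)
  also have "\<dots> = (\<Sum>j=0..n. icoeff f (z - int j) * fps_nth g j)"
    by (rule sum.cong) (auto simp: z icoeff_def nat_diff_distrib')
  also have "\<dots> = (\<Sum>j\<in>{0..max m n}. icoeff f (z - int j) * fps_nth g j)"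
    by (rule sum.mono_neutral_left) (auto simp: z icoeff_def)
  also have "\<dots> = (\<Sum>j\<le>m. icoeff f (z - int j) * fps_nth g j)"
    by (rule sum.mono_neutral_right) (auto simp: assms)
  finally show ?thesis .
qed

lemma lin_prod_nth_0: "finite J \<Longrightarrow> fps_nth (\<Prod>j\<in>J. lin (c j)) 0 = 1"
  by (induction J rule: finite_induct) (simp_all add: lin_nth_mult)

lemma lin_prod_bounded: "finite J \<Longrightarrow> m > card J \<Longrightarrow> fps_nth (\<Prod>j\<in>J. lin (c j)) m = 0"
proof (induction J arbitrary: m rule: finite_induct)
  case (insert x J)
  then show ?case by (simp add: lin_nth_mult)
qed simp

text \<open>From degree \<open>card J\<close> on, the coefficient contains every signed elementary
  symmetric polynomial of the c_j, each times a power of \<open>a\<close>; together they form the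
  expanded product of the a - c_j.\<close>

lemma lin_prod_geom_nth:
  assumes "finite J" "m \<ge> card J"
  shows "fps_nth ((\<Prod>j\<in>J. lin (c j)) * geom a) m = a ^ (m - card J) * (\<Prod>j\<in>J. a - c j)"
  using assms
proof (induction J arbitrary: m rule: finite_induct)
  case empty
  then show ?case by (simp add: geom_def)
next
  case (insert x J)
  then obtain k where k: "m = Suc (k + card J)" by (auto simp: le_iff_add add_ac)
  have "fps_nth ((\<Prod>j\<in>insert x J. lin (c j)) * geom a) m =
     fps_nth ((\<Prod>j\<in>J. lin (c j)) * geom a) m - c x * fps_nth ((\<Prod>j\<in>J. lin (c j)) * geom a) (m - 1)"
    using insert(1,2) k by (simp add: lin_nth_mult mult.assoc)
  also have "\<dots> = a ^ (m - card (insert x J)) * (\<Prod>j\<in>insert x J. a - c j)"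
  proof -
    let ?P = "\<Prod>j\<in>J. a - c j"
    have "fps_nth ((\<Prod>j\<in>J. lin (c j)) * geom a) m = a ^ Suc k * ?P"
      "fps_nth ((\<Prod>j\<in>J. lin (c j)) * geom a) (m - 1) = a ^ k * ?P"
      using insert.IH[of m] insert.IH[of "m - 1"] by (simp_all add: k Suc_diff_le)
    then show ?thesis using insert(1,2) by (simp add: k algebra_simps)
  qed
  finally show ?case .
qed

subsection \<open>Determinants agreeing outside one row\<close>

lemma cofactor_cong:
  assumes "A \<in> carrier_mat n n" "B \<in> carrier_mat n n"
    and "\<And>i j. i < n \<Longrightarrow> j < n \<Longrightarrow> i \<noteq> k \<Longrightarrow> A $$ (i, j) = B $$ (i, j)" "k < n" "l < n"
  shows "cofactor A k l = cofactor B k l"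
proof -
  have "mat_delete A k l = mat_delete B k l"
    unfolding mat_delete_def using assms by (intro eq_matI) auto
  then show ?thesis by (simp add: cofactor_def)
qed

text \<open>Laplace expansion along row \<open>k\<close>, whose cofactors the three matrices
  share.\<close>

lemma det_row_difference:
  assumes A: "A \<in> carrier_mat n n" "B \<in> carrier_mat n n" "D \<in> carrier_mat n n" and k: "k < n"
    and same: "\<And>i j. i < n \<Longrightarrow> j < n \<Longrightarrow> i \<noteq> k \<Longrightarrow> A $$ (i, j) = D $$ (i, j)"
      "\<And>i j. i < n \<Longrightarrow> j < n \<Longrightarrow> i \<noteq> k \<Longrightarrow> B $$ (i, j) = D $$ (i, j)"
    and row: "\<And>j. j < n \<Longrightarrow> A $$ (k, j) - B $$ (k, j) = c * D $$ (k, j)"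
  shows "det A - det B = c * det (D :: 'a::comm_ring_1 mat)"
proof -
  have "det A - det B = (\<Sum>j<n. A $$ (k, j) * cofactor A k j) - (\<Sum>j<n. B $$ (k, j) * cofactor B k j)"
    by (simp add: laplace_expansion_row[OF A(1) k] laplace_expansion_row[OF A(2) k])
  also have "\<dots> = (\<Sum>j<n. (A $$ (k, j) - B $$ (k, j)) * cofactor D k j)"
    unfolding sum_subtractf[symmetric]
    by (rule sum.cong) (use A k same cofactor_cong[of A n D k] cofactor_cong[of B n D k] in
        \<open>auto simp: algebra_simps\<close>)
  also have "\<dots> = c * det D"
    unfolding laplace_expansion_row[OF A(3) k] sum_distrib_left
    by (rule sum.cong) (auto simp: row)
  finally show ?thesis .
qed

subsection \<open>The determinantal formula for shifted longest permutations\<close>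

text \<open>Generating series of the double complete symmetric polynomials in x_1, ..., x_r and y_1,
  ..., y_(L-q).\<close>

definition row_series :: "int \<Rightarrow> int \<Rightarrow> int \<Rightarrow> cxy_poly fps" where
  "row_series L q r = (\<Prod>j\<in>{1..L - q}. lin (yv j)) * (\<Prod>i\<in>{1..r}. geom (xv i))"

text \<open>For \<open>s\<close> other than \<open>r\<close>, the interval {1..s} contains both r
  and r + 1 or neither.\<close>

lemma prod_geom_transpose:
  assumes "1 \<le> r" "s \<noteq> r"
  shows "(\<Prod>i\<in>{1..s}. geom (xv (transpose r (r + 1) i))) = (\<Prod>i\<in>{1..s}. geom (xv i))"
  by (rule prod.reindex_bij_betw, rule bij_betwI[where g = "transpose r (r + 1)"])
     (use assms in \<open>auto simp: transpose_def\<close>)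

lemma swap_x_row_series_other:
  assumes "1 \<le> r" "s \<noteq> r"
  shows "ev_fps (\<lambda>v. indet (swap_indet r v)) (row_series L q s) = row_series L q s"
  using prod_geom_transpose[OF assms]
  by (simp add: row_series_def ev_fps_mult ev_fps_prod swap_indet_def)

lemma swap_x_row_series:
  assumes "1 \<le> r"
  shows "row_series L q r - ev_fps (\<lambda>v. indet (swap_indet r v)) (row_series L q r) =
         fps_const (xv r - xv (r + 1)) * fps_X * row_series L q (r + 1)"
proof -
  have "{1..r} = insert r {1..r - 1}" "{1..r + 1} = insert (r + 1) (insert r {1..r - 1})"
    using assms by auto
  then have *: "row_series L q r = row_series L q (r - 1) * geom (xv r)"
      "row_series L q (r + 1) = row_series L q (r - 1) * (geom (xv r) * geom (xv (r + 1)))"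
    by (simp_all add: row_series_def mult_ac)
  have "row_series L q r - ev_fps (\<lambda>v. indet (swap_indet r v)) (row_series L q r) =
        row_series L q (r - 1) * (geom (xv r) - geom (xv (r + 1)))"
    unfolding * ev_fps_mult using swap_x_row_series_other[OF assms, of "r - 1" L q]
    by (simp add: swap_indet_def right_diff_distrib)
  then show ?thesis by (simp add: geom_diff * mult_ac)
qed

text \<open>The reversal of \<open>{p + 1, \<dots>, p + n + 1}\<close> is reached from a dominant permutation by moving,
  for \<open>k = n, \<dots>, 1\<close>, the \<open>k\<close>-th value \<open>p\<close> places to the right.  In state \<open>(k, r)\<close> this value is
  at position \<open>r\<close>, and \<open>x\<^sub>r, x\<^bsub>r + 1\<^esub>\<close> enter asymmetrically only in row \<open>k\<close> of the determinant,
  which involves \<open>x\<^sub>1, \<dots>, x\<^sub>r\<close>; row \<open>q\<close> involves \<open>x\<^sub>1, \<dots>, x\<^sub>q\<close> before its turn and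
  \<open>x\<^sub>1, \<dots>, x\<^bsub>p + q\<^esub>\<close> after it.\<close>

definition row_range :: "int \<Rightarrow> int \<Rightarrow> int \<Rightarrow> int \<Rightarrow> int" where
  "row_range p k r q = (if q < k then q else if q = k then r else p + q)"

text \<open>The index falls by 1 when \<open>r\<close> grows by 1, matching the factor
  \<open>fps_X\<close> in \<open>swap_x_row_series\<close>.\<close>

definition flag_entry :: "int \<Rightarrow> int \<Rightarrow> int \<Rightarrow> nat \<Rightarrow> cxy_poly" where
  "flag_entry L q r l = icoeff (row_series L q r) (L - r - q + 1 + int l)"

definition flag_mat :: "int \<Rightarrow> nat \<Rightarrow> int \<Rightarrow> int \<Rightarrow> cxy_poly mat" where
  "flag_mat p n k r = mat n n (\<lambda>(a, l). flag_entry (p + int n + 1) (int a + 1) (row_range p k r (int a + 1)) l)"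

lemma flag_mat_carrier [simp]: "flag_mat p n k r \<in> carrier_mat n n"
  by (simp add: flag_mat_def)

lemma divided_difference_flag_mat:
  assumes k: "1 \<le> k" "k \<le> int n" and r: "k \<le> r" "r < k + p"
  shows "divided_difference r (det (flag_mat p n k r)) = det (flag_mat p n k (r + 1))"
proof (rule divided_difference_eqI)
  let ?s = "\<lambda>v. indet (swap_indet r v)"
  have "det (flag_mat p n k r) - det (map_mat (ev ?s) (flag_mat p n k r)) =
        (xv r - xv (r + 1)) * det (flag_mat p n k (r + 1))"
  proof (rule det_row_difference[where k = "nat (k - 1)"])
    show "nat (k - 1) < n" using k by linarith
    fix i j assume ij: "i < n" "j < n" "i \<noteq> nat (k - 1)"
    then have ik: "int i + 1 \<noteq> k" by auto
    then show "flag_mat p n k r $$ (i, j) = flag_mat p n k (r + 1) $$ (i, j)"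
      using ij by (simp add: flag_mat_def row_range_def)
    \<comment> \<open>A row q < k has range q < k <= r, a row q > k has range p + q > p + k >
      r.\<close>
    have "row_range p k r (int i + 1) \<noteq> r"
      using ik r by (auto simp: row_range_def)
    then show "map_mat (ev ?s) (flag_mat p n k r) $$ (i, j) = flag_mat p n k (r + 1) $$ (i, j)"
      using ij ik k r
      by (simp add: flag_mat_def flag_entry_def ev_icoeff swap_x_row_series_other)
         (simp add: row_range_def)
  next
    fix j assume j: "j < n"
    have "row_range p k s k = s" for s by (simp add: row_range_def)
    then show "flag_mat p n k r $$ (nat (k - 1), j) - map_mat (ev ?s) (flag_mat p n k r) $$ (nat (k - 1), j) =
        (xv r - xv (r + 1)) * flag_mat p n k (r + 1) $$ (nat (k - 1), j)"
      using j k r by (simp add: flag_mat_def flag_entry_def ev_icoeff icoeff_diff[symmetric]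
          swap_x_row_series icoeff_const_X_mult) (simp add: algebra_simps)
  qed simp_all
  then show "(xv r - xv (r + 1)) * det (flag_mat p n k (r + 1)) =
      det (flag_mat p n k r) - swap_x r (det (flag_mat p n k r))"
    by (simp add: swap_x_ev)
qed

text \<open>With L = p + n + 1, the one-line notation is L, ..., L - k + 2, then 1, ..., p in
  increasing order with L - k + 1 inserted at position \<open>r\<close>, then L - k, ..., p +
  1.\<close>

definition flag_perm :: "int \<Rightarrow> nat \<Rightarrow> int \<Rightarrow> int \<Rightarrow> int \<Rightarrow> int" where
  "flag_perm p n k r i =
     (if i < 1 \<or> i > p + int n + 1 then i
      else if i < k then p + int n + 2 - i
      else if i < r then i - k + 1
      else if i = r then p + int n + 2 - k
      else if i \<le> k + p then i - k
      else 2 * p + int n + 2 - i)"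

lemma schubert_class_flag_step:
  assumes "1 \<le> k" "k \<le> int n" "k \<le> r" "r < k + p"
    and "schubert_class (flag_perm p n k r) (det (flag_mat p n k r))"
  shows "schubert_class (flag_perm p n k (r + 1)) (det (flag_mat p n k (r + 1)))"
proof -
  have "flag_perm p n k r (r + 1) < flag_perm p n k r r"
    using assms(1-4) by (simp add: flag_perm_def)
  moreover have "flag_perm p n k r \<circ> transpose r (r + 1) = flag_perm p n k (r + 1)"
    using assms(1-4) by (auto simp: fun_eq_iff flag_perm_def transpose_def)
  ultimately show ?thesis
    using schubert_class_divided_difference[OF assms(5), of r] divided_difference_flag_mat[OF assms(1-4)] assms(1,3)
    by simp
qed

lemma schubert_class_flag_row:
  assumes "1 \<le> k" "k \<le> int n" "0 \<le> p"
    and "schubert_class (flag_perm p n k k) (det (flag_mat p n k k))"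
  shows "schubert_class (flag_perm p n k (k + p)) (det (flag_mat p n k (k + p)))"
proof -
  have "schubert_class (flag_perm p n k (k + int j)) (det (flag_mat p n k (k + int j)))" if "int j \<le> p" for j
    using that
  proof (induction j)
    case 0
    then show ?case using assms by simp
  next
    case (Suc j)
    then show ?case using schubert_class_flag_step[of k n "k + int j" p] assms by (simp add: add_ac)
  qed
  from this[of "nat p"] show ?thesis using assms by simp
qed

text \<open>After \<open>p\<close> moves the \<open>k\<close>-th value stands right before the
  decreasing tail, and the value at position k - 1 is next to move.\<close>

lemma flag_next_row:
  assumes "2 \<le> k" "k \<le> int n" "0 \<le> p"
  shows "flag_perm p n k (k + p) = flag_perm p n (k - 1) (k - 1)"
    and "flag_mat p n k (k + p) = flag_mat p n (k - 1) (k - 1)"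
proof -
  show "flag_perm p n k (k + p) = flag_perm p n (k - 1) (k - 1)"
    using assms by (auto simp: fun_eq_iff flag_perm_def)
  have "row_range p k (k + p) = row_range p (k - 1) (k - 1)"
    by (auto simp: fun_eq_iff row_range_def)
  then show "flag_mat p n k (k + p) = flag_mat p n (k - 1) (k - 1)"
    by (simp add: flag_mat_def)
qed

lemma schubert_class_flag_all:
  assumes "1 \<le> n" "0 \<le> p"
    and "schubert_class (flag_perm p n n n) (det (flag_mat p n n n))"
  shows "schubert_class (flag_perm p n 1 (1 + p)) (det (flag_mat p n 1 (1 + p)))"
proof -
  have "schubert_class (flag_perm p n (int n - int j) (int n - int j)) (det (flag_mat p n (int n - int j) (int n - int j)))"
    if "j < n" for j
    using that
  proof (induction j)
    case 0
    then show ?case using assms by simp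
  next
    case (Suc j)
    let ?k = "int n - int j"
    have "schubert_class (flag_perm p n ?k (?k + p)) (det (flag_mat p n ?k (?k + p)))"
      using Suc assms by (intro schubert_class_flag_row) auto
    moreover have "2 \<le> ?k" "?k \<le> int n" "?k - 1 = int n - int (Suc j)" using Suc by auto
    ultimately show ?case using flag_next_row[of ?k n p] assms by simp
  qed
  from this[of "n - 1"] have "schubert_class (flag_perm p n 1 1) (det (flag_mat p n 1 1))"
    using assms by (simp add: of_nat_diff)
  then show ?thesis using assms by (intro schubert_class_flag_row) auto
qed

lemma flag_perm_final: "0 \<le> p \<Longrightarrow> flag_perm p n 1 (1 + p) = reversal (p + 1) (p + int n + 1)"
  by (auto simp: fun_eq_iff flag_perm_def reversal_def)

text \<open>With L = p + n + 1, the starting permutation reads L, L - 1, ..., p + 2, 1, ..., p + 1,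
  so row i <= n of its diagram consists of the values below L + 1 - i.\<close>

lemma flag_perm_dominant:
  assumes "1 \<le> n" "0 \<le> p"
  shows "flag_perm p n n n \<in> S_plus"
    and "rothe (flag_perm p n n n) = (SIGMA i:{1..int n}. {1..p + int n + 1 - i})"
proof -
  let ?v = "flag_perm p n n n"
  let ?L = "p + int n + 1"
  define g where "g j = (if j < 1 \<or> j > ?L then j else if j \<le> p + 1 then j + int n else ?L + 1 - j)" for j
  have gv: "g \<circ> ?v = id" "?v \<circ> g = id"
    using assms by (auto simp: fun_eq_iff g_def flag_perm_def)
  then have inv: "inv ?v = g" by (intro inv_unique_comp)
  have "finite {i. ?v i \<noteq> i}"
    by (rule finite_subset[of _ "{1..?L}"]) (auto simp: flag_perm_def)
  then show "?v \<in> S_plus"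
    using o_bij[OF gv] by (auto simp: S_plus_def S_Z_def) (simp add: flag_perm_def)
  have "k < ?v i \<and> i < g k \<longleftrightarrow> 1 \<le> i \<and> i \<le> int n \<and> 1 \<le> k \<and> k \<le> ?L - i" for i k
  proof (cases "1 \<le> i \<and> i \<le> int n")
    case True
    then show ?thesis using assms by (auto simp: flag_perm_def g_def)
  next
    case False
    then show ?thesis using assms
      by (cases "i < 1"; cases "i > ?L") (auto simp: flag_perm_def g_def)
  qed
  then show "rothe ?v = (SIGMA i:{1..int n}. {1..?L - i})"
    by (auto simp: rothe_def inv)
qed

text \<open>Multiplication by \<open>U\<close> multiplies the row series, in column l', by the 1 -
  x_i t with i <= l'. Above the diagonal all denominators cancel and the index exceeds the degree.
  On the diagonal of row q only 1/(1 - x_q t) survives, and \<open>lin_prod_geom_nth\<close> gives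
  the product of the x_q - y_j.\<close>

lemma det_flag_mat_dominant:
  assumes "0 \<le> p"
  shows "det (flag_mat p n n n) =
         (\<Prod>(i, j)\<in>(SIGMA i:{1..int n}. {1..p + int n + 1 - i}). xv i - yv j)"
proof -
  let ?L = "p + int n + 1"
  let ?M = "flag_mat p n n n"
  \<comment> \<open>A unitriangular matrix of signed elementary symmetric polynomials makes \<open>?M\<close> triangular.\<close>
  define E where "E l = (\<Prod>i\<in>{1..int l}. lin (xv i))" for l
  define U where "U = mat n n (\<lambda>(l, l'). icoeff (E l') (int l' - int l))"
  have U: "U \<in> carrier_mat n n" by (simp add: U_def)
  have detU: "det U = 1"
  proof -
    have "upper_triangular U" by (auto simp: U_def icoeff_def)
    then have "det U = prod_list (diag_mat U)" using U by (rule det_upper_triangular)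
    also have "\<dots> = (\<Prod>i=0..<n. U $$ (i, i))" using U by (simp add: prod_list_diag_prod)
    also have "\<dots> = 1"
      by (rule prod.neutral) (auto simp: U_def icoeff_def E_def lin_prod_nth_0)
    finally show ?thesis .
  qed
  have entry: "(?M * U) $$ (a, l') =
      icoeff (row_series ?L (int a + 1) (int a + 1) * E l') (?L - 2 * int a - 1 + int l')"
    if "a < n" "l' < n" for a l'
  proof -
    have rr: "row_range p (int n) (int n) (int a + 1) = int a + 1"
      using that by (auto simp: row_range_def)
    let ?f = "\<lambda>j. icoeff (row_series ?L (int a + 1) (int a + 1)) (?L - 2 * int a - 1 + int l' - int j) *
       fps_nth (E l') j"
    let ?h = "\<lambda>l. icoeff (row_series ?L (int a + 1) (int a + 1)) (?L - 2 * int a - 1 + int l) *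
       icoeff (E l') (int l' - int l)"
    have "(?M * U) $$ (a, l') = (\<Sum>l<n. ?h l)"
      using that U
      by (simp add: scalar_prod_def times_mat_def U_def flag_mat_def flag_entry_def rr atLeast0LessThan)
    \<comment> \<open>For l > l' the entry of \<open>U\<close> is a coefficient of negative
      index.\<close>
    also have "\<dots> = (\<Sum>l\<le>l'. ?h l)"
      by (rule sum.mono_neutral_right) (use that in \<open>auto simp: icoeff_def\<close>)
    also have "\<dots> = (\<Sum>j\<le>l'. ?f j)"
    proof (rule sum.reindex_bij_witness[of _ "\<lambda>j. l' - j" "\<lambda>l. l' - l"])
      fix l assume "l \<in> {..l'}"
      then have "icoeff (E l') (int l' - int l) = fps_nth (E l') (l' - l)"
        "?L - 2 * int a - 1 + int l' - int (l' - l) = ?L - 2 * int a - 1 + int l"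
        by (simp_all flip: of_nat_diff icoeff_of_nat)
      then show "?f (l' - l) = ?h l" by (simp only:)
    qed auto
    also have "\<dots> = icoeff (row_series ?L (int a + 1) (int a + 1) * E l') (?L - 2 * int a - 1 + int l')"
      by (rule icoeff_mult_bounded[symmetric]) (simp add: E_def lin_prod_bounded)
    finally show ?thesis .
  qed
  have GE: "(\<Prod>i\<in>A. geom (xv i)) * (\<Prod>i\<in>A. lin (xv i)) = 1" for A
    unfolding prod.distrib[symmetric] by (rule prod.neutral) (simp add: geom_lin)
  have upper: "(?M * U) $$ (a, l') = 0" if "a < l'" "l' < n" for a l'
  proof -
    let ?q = "int a + 1"
    have "{1..int l'} = {1..?q} \<union> {?q + 1..int l'}" "{1..?q} \<inter> {?q + 1..int l'} = {}" using that by auto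
    then have "E l' = (\<Prod>i\<in>{1..?q}. lin (xv i)) * (\<Prod>i\<in>{?q + 1..int l'}. lin (xv i))"
      unfolding E_def by (simp add: prod.union_disjoint)
    then have "row_series ?L ?q ?q * E l' =
        (\<Prod>j\<in>{1..?L - ?q}. lin (yv j)) * (\<Prod>i\<in>{?q + 1..int l'}. lin (xv i)) *
        ((\<Prod>i\<in>{1..?q}. geom (xv i)) * (\<Prod>i\<in>{1..?q}. lin (xv i)))"
      by (simp add: row_series_def mult_ac)
    then have RE: "row_series ?L ?q ?q * E l' =
        (\<Prod>j\<in>{1..?L - ?q}. lin (yv j)) * (\<Prod>i\<in>{?q + 1..int l'}. lin (xv i))"
      by (simp add: GE)
    have "(?M * U) $$ (a, l') = icoeff (row_series ?L ?q ?q * E l') (?L - 2 * int a - 1 + int l')"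
      using that by (intro entry) auto
    also have "\<dots> = (\<Sum>j\<le>l' - a - 1. icoeff (\<Prod>j\<in>{1..?L - ?q}. lin (yv j)) (?L - 2 * int a - 1 + int l' - int j) *
        fps_nth (\<Prod>i\<in>{?q + 1..int l'}. lin (xv i)) j)"
      unfolding RE by (rule icoeff_mult_bounded) (simp add: lin_prod_bounded)
    \<comment> \<open>The index exceeds the total degree (L - q) + (l' - q) by exactly 1.\<close>
    also have "\<dots> = 0"
    proof (intro sum.neutral ballI)
      fix j assume "j \<in> {..l' - a - 1}"
      then have "nat (?L - ?q) < nat (?L - 2 * int a - 1 + int l' - int j)"
        using that assms by auto
      then have "icoeff (\<Prod>j\<in>{1..?L - ?q}. lin (yv j)) (?L - 2 * int a - 1 + int l' - int j) = 0"
        by (simp add: icoeff_def lin_prod_bounded del: nat_less_eq_zless)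
      then show "icoeff (\<Prod>j\<in>{1..?L - ?q}. lin (yv j)) (?L - 2 * int a - 1 + int l' - int j) *
          fps_nth (\<Prod>i\<in>{?q + 1..int l'}. lin (xv i)) j = 0" by simp
    qed
    finally show ?thesis .
  qed
  have diag: "(?M * U) $$ (a, a) = (\<Prod>j\<in>{1..?L - (int a + 1)}. xv (int a + 1) - yv j)" if "a < n" for a
  proof -
    let ?q = "int a + 1"
    have "{1..?q} = insert ?q {1..int a}" by auto
    then have "row_series ?L ?q ?q * E a =
        (\<Prod>j\<in>{1..?L - ?q}. lin (yv j)) * geom (xv ?q) *
        ((\<Prod>i\<in>{1..int a}. geom (xv i)) * (\<Prod>i\<in>{1..int a}. lin (xv i)))"
      by (simp add: row_series_def E_def mult_ac)
    \<comment> \<open>The index equals the number of linear factors, so no extra power of x_q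
      appears.\<close>
    then have "(?M * U) $$ (a, a) = icoeff ((\<Prod>j\<in>{1..?L - ?q}. lin (yv j)) * geom (xv ?q)) (int (nat (?L - ?q)))"
      using entry[OF that that] that assms by (simp add: GE)
    then show ?thesis
      unfolding icoeff_of_nat by (simp add: lin_prod_geom_nth)
  qed
  have "det ?M = det ?M * det U" by (simp add: detU)
  also have "\<dots> = det (?M * U)" using U by (simp add: det_mult[of _ n])
  also have "\<dots> = prod_list (diag_mat (?M * U))"
    using U by (intro det_lower_triangular[of n]) (auto simp: upper intro: mult_carrier_mat[of _ n n])
  also have "\<dots> = (\<Prod>a=0..<n. (?M * U) $$ (a, a))"
    by (simp add: prod_list_diag_prod flag_mat_def)
  also have "\<dots> = (\<Prod>a=0..<n. \<Prod>j\<in>{1..?L - (int a + 1)}. xv (int a + 1) - yv j)"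
    by (rule prod.cong) (auto simp: diag)
  also have "\<dots> = (\<Prod>i\<in>{1..int n}. \<Prod>j\<in>{1..?L - i}. xv i - yv j)"
    by (rule prod.reindex_bij_witness[of _ "\<lambda>i. nat (i - 1)" "\<lambda>a. int a + 1"]) auto
  also have "\<dots> = (\<Prod>(i, j)\<in>(SIGMA i:{1..int n}. {1..?L - i}). xv i - yv j)"
    by (rule prod.Sigma) auto
  finally show ?thesis .
qed

text \<open>At r = p + q the indices lose their dependence on \<open>p\<close>: only the series
  still involve it, which is what permits a lift to \<Lambda>[x,y].\<close>

lemma double_schubert_reversal:
  assumes "1 \<le> n" "0 \<le> p"
  shows "double_schubert (reversal (p + 1) (p + int n + 1)) =
    det (mat n n (\<lambda>(a, l). icoeff (row_series (p + int n + 1) (int a + 1) (p + int a + 1)) (int n - 2 * int a + int l)))"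
proof -
  have "schubert_class (flag_perm p n n n) (det (flag_mat p n n n))"
    unfolding det_flag_mat_dominant[OF assms(2)]
    by (rule schubert_class_dominant) (use flag_perm_dominant[OF assms] in auto)
  then have "double_schubert (reversal (p + 1) (p + int n + 1)) = det (flag_mat p n 1 (1 + p))"
    using schubert_class_flag_all[OF assms] flag_perm_final[OF assms(2)] double_schubert_eqI by simp
  also have "flag_mat p n 1 (1 + p) =
    mat n n (\<lambda>(a, l). icoeff (row_series (p + int n + 1) (int a + 1) (p + int a + 1)) (int n - 2 * int a + int l))"
  proof -
    have "row_range p 1 (1 + p) (int a + 1) = p + int a + 1" for a by (auto simp: row_range_def)
    then show ?thesis by (simp add: flag_mat_def flag_entry_def algebra_simps)
  qed
  finally show ?thesis .
qed

subsection \<open>Specialization of the Chern series\<close>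

lemma lin_uminus: "1 + fps_const c * fps_X = lin (- c)"
  by (simp flip: fps_const_neg)

lemma right_inverse_lin: "fps_right_inverse (lin c) 1 = geom c"
proof -
  have "lin c * fps_right_inverse (lin c) 1 = 1" by (rule fps_right_inverse) simp
  then have "geom c * lin c * fps_right_inverse (lin c) 1 = geom c" by (simp add: mult.assoc)
  then show ?thesis by (simp only: geom_lin mult_1)
qed

definition chern_value :: "int \<Rightarrow> cxy_poly fps" where
  "chern_value m = (\<Prod>i\<in>{1..m}. lin (- yv i)) * (\<Prod>i\<in>{1..m}. geom (xv i))"

text \<open>The map taking F to gamma^m(F)(0,x,y) as a single substitution, for m > 0; see
  \<open>c_zero_gamma\<close>.\<close>

definition spec :: "int \<Rightarrow> indet \<Rightarrow> cxy_poly" where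
  "spec m v = (case v of
       C k \<Rightarrow> fps_nth (chern_value m) (Suc k)
     | X i \<Rightarrow> xv (i + m)
     | Y i \<Rightarrow> yv (i + m))"

lemma spec_simps [simp]: "spec m (X i) = xv (i + m)" "spec m (Y i) = yv (i + m)"
  by (simp_all add: spec_def)

lemma ev_uminus: "ev \<rho> (- f) = - ev \<rho> f"
  by (rule ev.hom_uminus)

lemma ev_fps_chern:
  assumes "fps_nth s 0 = 1" "\<And>k. \<rho> (C k) = fps_nth s (Suc k)"
  shows "ev_fps \<rho> chern = s"
proof (rule fps_ext)
  fix n show "fps_nth (ev_fps \<rho> chern) n = fps_nth s n"
    by (cases n) (simp_all add: chern_def cv_def assms)
qed

lemma chern_value_nth_0: "fps_nth (chern_value m) 0 = 1"
proof -
  have "fps_nth (\<Prod>i\<in>A. geom (xv i)) 0 = 1" for A :: "int set"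
    by (induction A rule: infinite_finite_induct) (simp_all add: geom_def)
  then show ?thesis by (simp add: chern_value_def lin_prod_nth_0)
qed

lemma ev_fps_spec_chern: "ev_fps (spec m) chern = chern_value m"
  by (rule ev_fps_chern) (simp_all add: chern_value_nth_0 spec_def)

lemma c_zero_gamma:
  assumes "m > 0"
  shows "c_zero (gamma m f) = ev (spec m) f"
proof -
  let ?z = "\<lambda>v. case v of C k \<Rightarrow> 0 | X i \<Rightarrow> xv i | Y i \<Rightarrow> yv i"
  have "quot (1 + fps_const (yv i) * fps_X) (lin (xv i)) = lin (- yv i) * geom (xv i)" for i
    by (simp only: lin_uminus quot_def right_inverse_lin)
  then have "gamma_chern m = chern * chern_value m"
    using assms by (simp add: gamma_chern_def chern_value_def prod.distrib)
  moreover have "ev_fps ?z chern = 1" by (rule ev_fps_chern) simp_all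
  moreover have "ev_fps ?z (chern_value m) = chern_value m"
    by (simp add: chern_value_def ev_fps_mult ev_fps_prod ev_uminus)
  ultimately have "ev_fps ?z (gamma_chern m) = chern_value m"
    by (simp add: ev_fps_mult)
  then have "ev ?z (fps_nth (gamma_chern m) k) = fps_nth (chern_value m) k" for k
    by (metis ev_fps_nth)
  then show ?thesis
    unfolding c_zero_def gamma_def subst_eq_ev ev_ev
    by (auto simp: spec_def intro!: arg_cong2[of _ _ _ _ ev] split: indet.splits)
qed

lemma prod_shift: "(\<Prod>i\<in>{a..b}. f (i + m)) = (\<Prod>i\<in>{a + m..b + m}. f (i :: int))"
  by (rule prod.reindex_bij_witness[of _ "\<lambda>i. i - m" "\<lambda>i. i + m"]) auto

lemma prod_split:
  assumes "0 \<le> p" "p \<le> m"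
  shows "(\<Prod>i\<in>{1..m}. f (i :: int)) = (\<Prod>i\<in>{1..p}. f i) * (\<Prod>i\<in>{p + 1..m}. f i)"
proof -
  have "{1..m} = {1..p} \<union> {p + 1..m}" "{1..p} \<inter> {p + 1..m} = {}" using assms by auto
  then show ?thesis by (simp add: prod.union_disjoint)
qed

lemma neg_y_ev: "neg_y = ev (\<lambda>v. case v of Y i \<Rightarrow> - yv i | _ \<Rightarrow> indet v)"
  by (auto simp: neg_y_def subst_eq_ev intro!: arg_cong[of _ _ ev] split: indet.splits)

lemma geom_lin_prod: "(\<Prod>i\<in>A. lin (f i)) * (\<Prod>i\<in>A. geom (f i)) = 1"
  unfolding prod.distrib[symmetric] by (rule prod.neutral) (simp add: lin_geom)

subsection \<open>Existence for long reversals\<close>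

text \<open>Reading \<open>chern\<close> as the product of (1 + y_i t)/(1 - x_i t) over i <= 0, this
  stands for the product of the 1 + y_j t with j <= a + n + 1 - q divided by that of the 1 - x_i t
  with i <= a + q.\<close>

definition back_stable_row :: "int \<Rightarrow> nat \<Rightarrow> int \<Rightarrow> cxy_poly fps" where
  "back_stable_row a n q =
     chern * ((\<Prod>i\<in>{a + 1..0}. lin (xv i)) * (\<Prod>i\<in>{a + 1..0}. geom (- yv i))) *
     ((\<Prod>j\<in>{a + 1..a + int n + 1 - q}. lin (- yv j)) * (\<Prod>i\<in>{a + 1..a + q}. geom (xv i)))"

lemma ev_spec_back_stable_row:
  assumes a: "a \<le> 0" "- a \<le> m" and q: "1 \<le> q" "q \<le> int n"
  shows "ev_fps (spec m) (back_stable_row a n q) =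
         ev_fps (\<lambda>v. case v of Y i \<Rightarrow> - yv i | _ \<Rightarrow> indet v) (row_series (m + a + int n + 1) q (m + a + q))"
proof -
  define p where "p = m + a"
  have p: "0 \<le> p" "p \<le> m" using a by (auto simp: p_def)
  have sh: "(\<Prod>i\<in>{a + 1..c}. f (i + m)) = (\<Prod>i\<in>{p + 1..c + m}. f i)" for f :: "int \<Rightarrow> cxy_poly fps" and c
    by (simp add: prod_shift p_def algebra_simps)
  have "ev_fps (spec m) (back_stable_row a n q) =
    chern_value m * ((\<Prod>i\<in>{p + 1..m}. lin (xv i)) * (\<Prod>i\<in>{p + 1..m}. geom (- yv i))) *
     ((\<Prod>j\<in>{p + 1..a + int n + 1 - q + m}. lin (- yv j)) * (\<Prod>i\<in>{p + 1..a + q + m}. geom (xv i)))"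
    by (simp add: back_stable_row_def ev_fps_mult ev_fps_prod ev_fps_spec_chern ev_uminus
        sh[of "\<lambda>i. lin (xv i)"] sh[of "\<lambda>i. geom (- yv i)"] sh[of "\<lambda>i. lin (- yv i)"] sh[of "\<lambda>i. geom (xv i)"]
        del: mult_minus_left fps_const_neg)
  \<comment> \<open>The first two groups cancel; the last two join at \<open>p\<close>, as 1 <= q <=
    n keeps both upper ends above \<open>p\<close>.\<close>
  also have "\<dots> = ((\<Prod>i\<in>{p + 1..m}. lin (- yv i)) * (\<Prod>i\<in>{p + 1..m}. geom (- yv i))) *
     ((\<Prod>i\<in>{p + 1..m}. lin (xv i)) * (\<Prod>i\<in>{p + 1..m}. geom (xv i))) *
     ((\<Prod>i\<in>{1..p}. lin (- yv i)) * (\<Prod>j\<in>{p + 1..a + int n + 1 - q + m}. lin (- yv j))) *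
     ((\<Prod>i\<in>{1..p}. geom (xv i)) * (\<Prod>i\<in>{p + 1..a + q + m}. geom (xv i)))"
    unfolding chern_value_def prod_split[OF p] by (simp only: mult_ac)
  also have "\<dots> = (\<Prod>i\<in>{1..a + int n + 1 - q + m}. lin (- yv i)) * (\<Prod>i\<in>{1..a + q + m}. geom (xv i))"
    using p q prod_split[of p "a + int n + 1 - q + m" "\<lambda>i. lin (- yv i)"]
      prod_split[of p "a + q + m" "\<lambda>i. geom (xv i)"]
    by (simp only: geom_lin_prod mult_1) (simp add: p_def)
  also have "\<dots> = ev_fps (\<lambda>v. case v of Y i \<Rightarrow> - yv i | _ \<Rightarrow> indet v) (row_series (m + a + int n + 1) q (m + a + q))"
  proof -
    have "a + int n + 1 - q + m = m + a + int n + 1 - q" "a + q + m = m + a + q" by simp_all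
    then show ?thesis by (simp only: row_series_def ev_fps_mult ev_fps_prod ev_fps_lin ev_fps_geom ev_indet indet.simps)
  qed
  finally show ?thesis .
qed

definition back_stable_det :: "int \<Rightarrow> nat \<Rightarrow> cxy_poly" where
  "back_stable_det a n = det (mat n n (\<lambda>(r, l). icoeff (back_stable_row a n (int r + 1)) (int n - 2 * int r + int l)))"

lemma gamma_perm_reversal: "gamma_perm m (reversal a b) = reversal (a + m) (b + m)"
  by (auto simp: gamma_perm_def reversal_def fun_eq_iff)

lemma ev_spec_back_stable_det:
  assumes "a \<le> 0" "- a \<le> m" "1 \<le> n"
  shows "ev (spec m) (back_stable_det a n) =
         neg_y (double_schubert (gamma_perm m (reversal (a + 1) (a + int n + 1))))"
proof -
  have rev: "gamma_perm m (reversal (a + 1) (a + int n + 1)) = reversal (m + a + 1) (m + a + int n + 1)"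
    by (simp add: gamma_perm_reversal algebra_simps)
  have "0 \<le> m + a" using assms by simp
  then show ?thesis
    unfolding back_stable_det_def rev double_schubert_reversal[OF assms(3) \<open>0 \<le> m + a\<close>] neg_y_ev ev.hom_det[symmetric]
    by (intro arg_cong[of _ _ det] eq_matI)
       (use assms in \<open>auto simp: ev_icoeff ev_spec_back_stable_row add.assoc\<close>)
qed

subsection \<open>Divided differences with coefficients in the Chern classes\<close>

text \<open>The Chern series behaves like \<open>\<Prod>\<^bsub>i \<le> 0\<^esub> (1 + y\<^sub>i) / (1 - x\<^sub>i)\<close>, so only exchanging
  \<open>x\<^sub>0\<close> and \<open>x\<^sub>1\<close> affects it.\<close>

definition chern_swap :: "int \<Rightarrow> indet \<Rightarrow> cxy_poly" where
  "chern_swap i v = (case v of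
       C k \<Rightarrow> if i = 0 then fps_nth (chern * lin (xv 0) * geom (xv 1)) (Suc k) else indet (C k)
     | _ \<Rightarrow> indet (swap_indet i v))"

text \<open>For i = 0: c - c (1 - x_0 t)/(1 - x_1 t) = (x_0 - x_1) t c/(1 - x_1 t).\<close>

lemma chern_swap_dvd: "(xv i - xv (i + 1)) dvd (indet v - chern_swap i v)"
proof (cases "\<exists>k. v = C k \<and> i = 0")
  case True
  then obtain k where k: "v = C k" "i = 0" by blast
  have factor: "u * (b * g) - u * a * g = (b - a) * (u * g)" for u a b g :: "cxy_poly fps"
    by (simp add: algebra_simps)
  have "chern - chern * lin (xv 0) * geom (xv 1) = chern * (lin (xv 1) * geom (xv 1)) - chern * lin (xv 0) * geom (xv 1)"
    by (simp only: lin_geom mult_1_right)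
  also have "\<dots> = (lin (xv 1) - lin (xv 0)) * (chern * geom (xv 1))"
    by (rule factor)
  also have "lin (xv 1) - lin (xv 0) = fps_const (xv 0 - xv 1) * fps_X"
    by (simp add: left_diff_distrib flip: fps_const_sub)
  also have "\<dots> * (chern * geom (xv 1)) = fps_const (xv 0 - xv 1) * (fps_X * chern * geom (xv 1))"
    by (simp only: mult.assoc)
  finally have "fps_nth (chern - chern * lin (xv 0) * geom (xv 1)) (Suc k) =
      (xv 0 - xv 1) * fps_nth (fps_X * chern * geom (xv 1)) (Suc k)"
    by (simp only: fps_mult_left_const_nth)
  moreover have "fps_nth chern (Suc k) = indet (C k)" by (simp add: chern_def cv_def)
  ultimately have "indet v - chern_swap i v = (xv i - xv (i + 1)) * fps_nth (fps_X * chern * geom (xv 1)) (Suc k)"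
    by (simp add: chern_swap_def k)
  then show ?thesis by simp
next
  case False
  then have "chern_swap i v = indet (swap_indet i v)"
    by (auto simp: chern_swap_def swap_indet_def split: indet.splits)
  then show ?thesis by (simp add: swap_indet_dvd)
qed

lemma swap_chern_value_other:
  assumes "1 \<le> r" "m \<noteq> r"
  shows "ev_fps (\<lambda>v. indet (swap_indet r v)) (chern_value m) = chern_value m"
  using prod_geom_transpose[OF assms]
  by (simp add: chern_value_def ev_fps_mult ev_fps_prod swap_indet_def ev_uminus)

text \<open>Here x_m leaves the denominator and x_(m+1) enters it, which is what
  \<open>chern_swap 0\<close> does to the Chern series.\<close>

lemma swap_chern_value:
  assumes "1 \<le> m"
  shows "ev_fps (\<lambda>v. indet (swap_indet m v)) (chern_value m) = chern_value m * lin (xv m) * geom (xv (m + 1))"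
proof -
  have ins: "{1..m} = insert m {1..m - 1}" using assms by auto
  have *: "(\<Prod>i\<in>{1..m - 1}. geom (xv (transpose m (m + 1) i))) = (\<Prod>i\<in>{1..m - 1}. geom (xv i))"
    using assms by (intro prod_geom_transpose) auto
  let ?P = "\<Prod>i\<in>{1..m}. lin (- yv i)" and ?Q = "\<Prod>i\<in>{1..m - 1}. geom (xv i)"
  have "ev_fps (\<lambda>v. indet (swap_indet m v)) (chern_value m) = ?P * (geom (xv (m + 1)) * ?Q)"
  proof -
    have "(\<Prod>i\<in>{1..m}. geom (xv i)) = geom (xv m) * ?Q" by (simp add: ins)
    then show ?thesis
      by (simp add: chern_value_def ev_fps_mult ev_fps_prod swap_indet_def ev_uminus *)
  qed
  also have "\<dots> = ?P * (geom (xv m) * ?Q) * lin (xv m) * geom (xv (m + 1))"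
  proof -
    have "?P * (geom (xv m) * ?Q) * lin (xv m) * geom (xv (m + 1)) =
          ?P * (geom (xv (m + 1)) * ?Q) * (lin (xv m) * geom (xv m))"
      by (simp only: mult_ac)
    then show ?thesis by (simp only: lin_geom mult_1_right)
  qed
  also have "geom (xv m) * ?Q = (\<Prod>i\<in>{1..m}. geom (xv i))" by (simp add: ins)
  finally show ?thesis by (simp only: chern_value_def)
qed

text \<open>It suffices to compare indeterminates. On the Chern classes, i = 0 is
  \<open>swap_chern_value\<close>; for other i the exchange fixes
  \<open>chern_value m\<close>.\<close>

lemma spec_chern_swap:
  assumes "m > 0" "i + m \<ge> 1"
  shows "ev (spec m) (ev (chern_swap i) f) = swap_x (i + m) (ev (spec m) f)"
proof -
  let ?s = "\<lambda>v. indet (swap_indet (i + m) v)"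
  have tr: "transpose i (i + 1) j + m = transpose (i + m) (i + m + 1) (j + m)" for j
    by (auto simp: transpose_def)
  have "ev (spec m) (chern_swap i v) = ev ?s (spec m v)" for v
  proof (cases v)
    case (C k)
    show ?thesis
    proof (cases "i = 0")
      case True
      have "ev_fps (spec m) (chern * lin (xv 0) * geom (xv 1)) = ev_fps ?s (chern_value m)"
        using swap_chern_value[of m] assms True
        by (simp add: ev_fps_mult ev_fps_spec_chern add.commute)
      then have "ev (spec m) (fps_nth (chern * lin (xv 0) * geom (xv 1)) (Suc k)) =
          ev ?s (fps_nth (chern_value m) (Suc k))"
        by (metis ev_fps_nth)
      then show ?thesis using C True by (simp add: chern_swap_def spec_def)
    next
      case False
      then have "ev_fps ?s (chern_value m) = chern_value m"
        using assms by (intro swap_chern_value_other) auto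
      then have "ev ?s (fps_nth (chern_value m) (Suc k)) = fps_nth (chern_value m) (Suc k)"
        by (metis ev_fps_nth)
      then show ?thesis using C False by (simp add: chern_swap_def spec_def)
    qed
  next
    case (X j)
    then show ?thesis by (simp add: chern_swap_def swap_indet_def tr)
  next
    case (Y j)
    then show ?thesis by (simp add: chern_swap_def swap_indet_def)
  qed
  then show ?thesis by (simp add: swap_x_ev ev_ev)
qed

lemma neg_y_swap_x: "neg_y (swap_x i f) = swap_x i (neg_y f)"
  unfolding neg_y_ev swap_x_ev ev_ev
  by (auto simp: swap_indet_def ev_uminus intro!: arg_cong2[of _ _ _ _ ev] split: indet.splits)

lemma neg_y_divided_difference:
  "(xv i - xv (i + 1)) * neg_y (divided_difference i f) = neg_y f - swap_x i (neg_y f)"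
  using arg_cong[OF divided_difference_mult[of i f], of neg_y]
  by (simp add: neg_y_swap_x[symmetric]) (simp add: neg_y_ev ev_mult ev_diff)

lemma gamma_perm_S_plus:
  assumes "bij w" "\<And>i. i < a + 1 \<or> i > b \<Longrightarrow> w i = i" "- a \<le> m"
  shows "gamma_perm m w \<in> S_plus"
proof -
  have "gamma_perm m w = (\<lambda>i. i + m) \<circ> w \<circ> (\<lambda>i. i - m)" by (auto simp: gamma_perm_def)
  moreover have "bij (\<lambda>i::int. i + m)" "bij (\<lambda>i::int. i - m)"
    by (rule o_bij[of "\<lambda>i. i - m"]; auto)  (rule o_bij[of "\<lambda>i. i + m"]; auto)
  ultimately have "bij (gamma_perm m w)" using assms(1) by (simp add: bij_comp)
  moreover have "finite {i. gamma_perm m w i \<noteq> i}"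
  proof (rule finite_subset)
    show "{i. gamma_perm m w i \<noteq> i} \<subseteq> {a + 1 + m..b + m}"
    proof
      fix i assume "i \<in> {i. gamma_perm m w i \<noteq> i}"
      then show "i \<in> {a + 1 + m..b + m}"
        using assms(2)[of "i - m"] by (cases "i - m < a + 1 \<or> i - m > b") (auto simp: gamma_perm_def)
    qed
  qed simp
  moreover have "gamma_perm m w i = i" if "i \<le> 0" for i
    using assms(2)[of "i - m"] assms(3) that by (simp add: gamma_perm_def)
  ultimately show ?thesis by (simp add: S_plus_def S_Z_def)
qed

lemma gamma_perm_swap: "gamma_perm m (w \<circ> transpose i (i + 1)) = gamma_perm m w \<circ> transpose (i + m) (i + m + 1)"
proof
  fix j
  have "transpose i (i + 1) (j - m) = transpose (i + m) (i + m + 1) j - m"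
    by (auto simp: transpose_def)
  then show "gamma_perm m (w \<circ> transpose i (i + 1)) j = (gamma_perm m w \<circ> transpose (i + m) (i + m + 1)) j"
    by (simp add: gamma_perm_def)
qed

text \<open>The lift of a divided difference is the quotient of
  \<open>F - ev (chern_swap i) F\<close> by x_i - x_(i+1), which \<open>spec m\<close> carries to
  the divided difference at i + m.\<close>

lemma back_stable_exists_interval:
  assumes a: "a \<le> 0" and n: "1 \<le> n"
    and w: "bij w" "\<And>i. i < a + 1 \<or> i > a + int n + 1 \<Longrightarrow> w i = i"
  shows "\<exists>F. \<forall>m>0. - a \<le> m \<longrightarrow> ev (spec m) F = neg_y (double_schubert (gamma_perm m w))"
proof (rule reversal_induct[where a = "a + 1" and b = "a + int n + 1" and w = w])
  show "\<exists>F. \<forall>m>0. - a \<le> m \<longrightarrow> ev (spec m) F = neg_y (double_schubert (gamma_perm m (reversal (a + 1) (a + int n + 1))))"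
    using ev_spec_back_stable_det[OF a _ n] by blast
next
  fix w i
  assume w: "bij w" "\<And>i. i < a + 1 \<or> i > a + int n + 1 \<Longrightarrow> w i = i"
    and i: "a + 1 \<le> i" "i < a + int n + 1" "w i > w (i + 1)"
    and "\<exists>F. \<forall>m>0. - a \<le> m \<longrightarrow> ev (spec m) F = neg_y (double_schubert (gamma_perm m w))"
  then obtain F where F: "\<And>m. m > 0 \<Longrightarrow> - a \<le> m \<Longrightarrow> ev (spec m) F = neg_y (double_schubert (gamma_perm m w))"
    by blast
  \<comment> \<open>The quotient is formed before specializing, so one \<open>G\<close> serves all
    \<open>m\<close>.\<close>
  obtain G where G: "F - ev (chern_swap i) F = (xv i - xv (i + 1)) * G"
    using ev_diff_dvd[OF chern_swap_dvd] by (metis dvd_def)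
  have "ev (spec m) G = neg_y (double_schubert (gamma_perm m (w \<circ> transpose i (i + 1))))"
    if m: "m > 0" "- a \<le> m" for m
  proof -
    have i': "i + m \<ge> 1" using i m by linarith
    let ?d = "xv (i + m) - xv (i + m + 1)"
    have "?d * ev (spec m) G = ev (spec m) ((xv i - xv (i + 1)) * G)"
      by (simp add: ev_mult ev_diff add_ac)
    also have "\<dots> = ev (spec m) F - swap_x (i + m) (ev (spec m) F)"
      unfolding G[symmetric] ev_diff using spec_chern_swap[OF m(1) i'] by simp
    also have "\<dots> = ?d * neg_y (divided_difference (i + m) (double_schubert (gamma_perm m w)))"
      unfolding neg_y_divided_difference using F[OF m] by simp
    also have "divided_difference (i + m) (double_schubert (gamma_perm m w)) =
        double_schubert (gamma_perm m (w \<circ> transpose i (i + 1)))"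
      unfolding gamma_perm_swap
      by (rule double_schubert_swap[symmetric])
         (use gamma_perm_S_plus[OF w m(2)] i' i in \<open>auto simp: gamma_perm_def algebra_simps\<close>)
    finally show ?thesis using xv_diff_nonzero[of "i + m"] by (simp only: mult_cancel_left) simp
  qed
  then show "\<exists>F. \<forall>m>0. - a \<le> m \<longrightarrow> ev (spec m) F = neg_y (double_schubert (gamma_perm m (w \<circ> transpose i (i + 1))))"
    by blast
qed (use w in auto)

text \<open>If \<open>w\<close> moves a non-positive point, a + 1 is the smallest one; shifted by
  \<open>m\<close> it is still moved, hence positive when the shifted permutation lies in
  S_+.\<close>

lemma S_Z_lower_bound:
  assumes "w \<in> S_Z"
  obtains a where "a \<le> 0" "\<And>i. i \<le> a \<Longrightarrow> w i = i"
    "\<And>m. gamma_perm m w \<in> S_plus \<Longrightarrow> m > 0 \<Longrightarrow> - a \<le> m"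
proof (cases "\<forall>i\<le>0. w i = i")
  case True
  then show thesis using that[of 0] by simp
next
  case False
  let ?S = "{i. w i \<noteq> i \<and> i \<le> 0}"
  have fin: "finite ?S" using assms by (auto simp: S_Z_def intro: finite_subset)
  have ne: "?S \<noteq> {}" using False by auto
  let ?j = "Min ?S"
  have j: "w ?j \<noteq> ?j" "?j \<le> 0" using Min_in[OF fin ne] by auto
  show thesis
  proof (rule that[of "?j - 1"])
    show "?j - 1 \<le> 0" using j by simp
    show "w i = i" if "i \<le> ?j - 1" for i
      using Min_le[OF fin, of i] that j by fastforce
    show "- (?j - 1) \<le> m" if "gamma_perm m w \<in> S_plus" for m
    proof (rule ccontr)
      assume "\<not> - (?j - 1) \<le> m"
      then have "gamma_perm m w (?j + m) = ?j + m" using that by (auto simp: S_plus_def)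
      then show False using j by (simp add: gamma_perm_def)
    qed
  qed
qed

lemma back_stable_exists:
  assumes "w \<in> S_Z"
  shows "\<exists>F. \<forall>m. m > 0 \<and> gamma_perm m w \<in> S_plus \<longrightarrow>
           c_zero (gamma m F) = neg_y (double_schubert (gamma_perm m w))"
proof -
  obtain a where a: "a \<le> 0" "\<And>i. i \<le> a \<Longrightarrow> w i = i"
    "\<And>m. gamma_perm m w \<in> S_plus \<Longrightarrow> m > 0 \<Longrightarrow> - a \<le> m"
    using S_Z_lower_bound[OF assms] by blast
  obtain b where b: "\<And>i. i > b \<Longrightarrow> w i = i"
    using S_Z_bounded[OF assms] by blast
  define n where "n = nat (max 1 (b - a))"
  have n: "int n \<ge> b - a" "n \<ge> 1" unfolding n_def by linarith+
  have "\<exists>F. \<forall>m>0. - a \<le> m \<longrightarrow> ev (spec m) F = neg_y (double_schubert (gamma_perm m w))"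
  proof (rule back_stable_exists_interval[OF a(1), of n])
    show "w i = i" if "i < a + 1 \<or> i > a + int n + 1" for i
      using a(2)[of i] b[of i] that n by linarith
  qed (use n(2) S_Z_bij[OF assms] in simp_all)
  then show ?thesis using a(3) by (metis c_zero_gamma)
qed

subsection \<open>Uniqueness\<close>

lemma gen_insert_poly:
  "f \<in> gen (insert a A) \<Longrightarrow> \<exists>p. (\<forall>i. coeff p i \<in> gen A) \<and> poly p (indet a) = f"
proof (induction rule: gen.induct)
  case (gen_int n)
  then show ?case
    by (intro exI[of _ "[:of_int n:]"]) (auto simp: coeff_pCons gen.gen_int split: nat.splits)
next
  case (gen_times v f)
  then obtain p where p: "\<And>i. coeff p i \<in> gen A" "poly p (indet a) = f" by blast
  show ?case
  proof (cases "v = a")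
    case True
    then show ?thesis using p
      by (intro exI[of _ "pCons 0 p"]) (auto simp: coeff_pCons split: nat.splits)
  next
    case False
    then have "v \<in> A" using gen_times by simp
    then show ?thesis using p by (intro exI[of _ "Polynomial.smult (indet v) p"]) (auto intro: gen.gen_times)
  qed
next
  case (gen_add f g)
  then obtain p q where "\<And>i. coeff p i \<in> gen A" "poly p (indet a) = f"
    "\<And>i. coeff q i \<in> gen A" "poly q (indet a) = g" by blast
  then show ?case by (intro exI[of _ "p + q"]) (auto intro: gen.gen_add)
qed

text \<open>As a polynomial in the indeterminate \<open>a\<close>, \<open>f\<close> vanishes at all
  complex arguments, so its coefficients vanish at every point and the induction applies to
  them.\<close>

lemma ev_complex_vanishing:
  assumes "finite A" "f \<in> gen A" "\<And>\<rho> :: indet \<Rightarrow> complex. ev \<rho> f = 0"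
  shows "f = 0"
  using assms
proof (induction A arbitrary: f rule: finite_induct)
  case empty
  have "\<exists>n. f = of_int n" using empty(1)
    by (induction rule: gen.induct) (auto intro: of_int_add[symmetric])
  then obtain n where "f = of_int n" by blast
  then show ?case using empty(2) by (simp add: ev_of_int)
next
  case (insert a A)
  obtain p where p: "\<And>i. coeff p i \<in> gen A" "poly p (indet a) = f"
    using gen_insert_poly[OF insert.prems(1)] by blast
  have "coeff p i = 0" if i: "i \<le> degree p" for i
  proof (rule insert.IH[OF p(1)])
    fix \<rho> :: "indet \<Rightarrow> complex"
    have "(\<Sum>i\<le>degree p. ev \<rho> (coeff p i) * t ^ i) = 0" for t
    proof -
      have "ev (\<rho>(a := t)) (coeff p i) = ev \<rho> (coeff p i)" for i
        by (rule ev_cong_gen[OF p(1)]) (use insert(2) in auto)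
      moreover have "ev (\<rho>(a := t)) (poly p (indet a)) = 0" using insert.prems(2) p(2) by simp
      ultimately show ?thesis by (simp add: poly_altdef ev.hom_sum ev_mult ev.hom_power)
    qed
    then show "ev \<rho> (coeff p i) = 0" using i polyfun_eq_0[of "\<lambda>i. ev \<rho> (coeff p i)" "degree p"] by blast
  qed
  then have "p = 0" by (metis le_refl leading_coeff_0_iff)
  then show ?case using p(2) by simp
qed

text \<open>The r_j are the reciprocals of the roots, which are nonzero by the constant term, padded
  with zeros up to \<open>K\<close>.\<close>

lemma complex_poly_factors:
  fixes p :: "complex poly"
  assumes "poly p 0 = 1" "degree p \<le> K"
  shows "\<exists>r. p = (\<Prod>j<K. [:1, - r j:])"
  using assms
proof (induction K arbitrary: p)
  case 0
  then have "p = 1" by (auto elim!: degree_eq_zeroE simp: one_pCons)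
  then show ?case by simp
next
  case (Suc K)
  show ?case
  proof (cases "degree p = 0")
    case True
    then have "p = 1" using Suc by (auto elim!: degree_eq_zeroE simp: one_pCons)
    then show ?thesis by (intro exI[of _ "\<lambda>_. 0"]) (simp add: one_pCons[symmetric])
  next
    case False
    then obtain z where z: "poly p z = 0"
      using fundamental_theorem_of_algebra constant_degree by metis
    then have z0: "z \<noteq> 0" using Suc.prems by auto
    obtain q where q: "p = [:- z, 1:] * q" using z by (metis dvdE poly_eq_0_iff_dvd)
    have "q \<noteq> 0" using q False by auto
    then have "degree p = Suc (degree q)" unfolding q by (subst degree_mult_eq) auto
    \<comment> \<open>Rescaling the quotient by -z restores the constant term 1.\<close>
    moreover have "poly (Polynomial.smult (- z) q) 0 = 1" using Suc.prems(1) q by simp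
    ultimately obtain r where r: "Polynomial.smult (- z) q = (\<Prod>j<K. [:1, - r j:])"
      using Suc.IH[of "Polynomial.smult (- z) q"] Suc.prems(2) z0 by auto
    have p: "[:1, - inverse z:] * Polynomial.smult (- z) q = p"
      unfolding q using z0 by (simp add: algebra_simps)
    have "(\<Prod>j<K. [:1, - (r(K := inverse z)) j:]) = (\<Prod>j<K. [:1, - r j:])"
      by (rule prod.cong) auto
    then have "(\<Prod>j<Suc K. [:1, - (r(K := inverse z)) j:]) = Polynomial.smult (- z) q * [:1, - inverse z:]"
      unfolding prod.lessThan_Suc r by (simp only: fun_upd_same)
    then have "p = (\<Prod>j<Suc K. [:1, - (r(K := inverse z)) j:])"
      using p by (simp only: mult.commute)
    then show ?thesis by blast
  qed
qed

lemma complex_series_factors: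
  fixes d :: "complex fps"
  assumes "fps_nth d 0 = 1"
  shows "\<exists>r. \<forall>n\<le>K. fps_nth (\<Prod>j<K. lin (r j)) n = fps_nth d n"
proof -
  define p where "p = (\<Sum>n\<le>K. Polynomial.monom (fps_nth d n) n)"
  have c: "coeff p n = (if n \<le> K then fps_nth d n else 0)" for n
    by (simp add: p_def coeff_sum)
  have "degree p \<le> K" by (rule degree_le) (simp add: c)
  moreover have "poly p 0 = 1" using assms by (simp add: poly_0_coeff_0 c)
  ultimately obtain r where r: "p = (\<Prod>j<K. [:1, - r j:])" using complex_poly_factors by blast
  have "fps_of_poly [:1, - z:] = lin z" for z :: complex
    by (simp add: fps_of_poly_pCons)
  then have "fps_of_poly p = (\<Prod>j<K. lin (r j))" unfolding r by (simp only: fps_of_poly_prod)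
  then show ?thesis using c by (metis fps_of_poly_nth)
qed

lemma lin_geom_prod_nth_0:
  fixes f g :: "int \<Rightarrow> complex"
  assumes "finite A"
  shows "fps_nth (\<Prod>i\<in>A. geom (f i) * lin (g i)) 0 = 1"
  using assms by (induction A rule: finite_induct) (simp_all add: geom_def)

text \<open>The elementary symmetric functions of the remaining \<open>y\<^sub>j\<close> take arbitrary values because the
  complex numbers are algebraically closed.\<close>

lemma spec_surjective:
  fixes \<rho> :: "indet \<Rightarrow> complex"
  assumes "int K + N < m" "0 \<le> N"
  shows "\<exists>\<theta>. (\<forall>k<K. ev \<theta> (spec m (C k)) = \<rho> (C k)) \<and>
     (\<forall>i\<ge>-N. ev \<theta> (spec m (X i)) = \<rho> (X i) \<and> ev \<theta> (spec m (Y i)) = \<rho> (Y i))"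
proof -
  \<comment> \<open>Indices j > M are those with j - m >= -N, whose values are prescribed; y_1, ...,
    y_K stay free since K <= M.\<close>
  define M where "M = m - N - 1"
  have M: "int K \<le> M" "0 \<le> M" "M \<le> m" using assms by (auto simp: M_def)
  define c where "c = Abs_fps (\<lambda>n. case n of 0 \<Rightarrow> 1 | Suc k \<Rightarrow> \<rho> (C k))"
  \<comment> \<open>The prescribed values contribute \<open>R\<close> to the Chern series. With
    inverse \<open>S\<close>, the free part has to agree with \<open>c * S\<close> up to order
    \<open>K\<close>.\<close>
  define R where "R = (\<Prod>i\<in>{M + 1..m}. lin (- \<rho> (Y (i - m))) * geom (\<rho> (X (i - m))))"
  define S where "S = (\<Prod>i\<in>{M + 1..m}. geom (- \<rho> (Y (i - m))) * lin (\<rho> (X (i - m))))"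
  have RS: "S * R = 1"
    unfolding R_def S_def prod.distrib[symmetric]
  proof (rule prod.neutral, rule ballI)
    fix i
    let ?a = "- \<rho> (Y (i - m))" and ?b = "\<rho> (X (i - m))"
    have "geom ?a * lin ?b * (lin ?a * geom ?b) = (geom ?a * lin ?a) * (lin ?b * geom ?b)"
      by (simp only: mult_ac)
    then show "geom ?a * lin ?b * (lin ?a * geom ?b) = 1" by (simp only: geom_lin lin_geom mult_1)
  qed
  have "fps_nth (c * S) 0 = 1"
    by (simp add: c_def S_def lin_geom_prod_nth_0)
  then obtain r where r: "\<And>n. n \<le> K \<Longrightarrow> fps_nth (\<Prod>j<K. lin (r j)) n = fps_nth (c * S) n"
    using complex_series_factors by blast
  define \<theta> where "\<theta> v = (case v of C k \<Rightarrow> 0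
     | X j \<Rightarrow> if j > M then \<rho> (X (j - m)) else 0
     | Y j \<Rightarrow> if j > M then \<rho> (Y (j - m)) else if 1 \<le> j \<and> j \<le> int K then - r (nat (j - 1)) else 0)" for v
  have "ev_fps \<theta> (chern_value m) = (\<Prod>i\<in>{1..m}. lin (- \<theta> (Y i)) * geom (\<theta> (X i)))"
    by (simp add: chern_value_def ev_fps_mult ev_fps_prod prod.distrib ev_uminus)
  also have "\<dots> = (\<Prod>i\<in>{1..M}. lin (- \<theta> (Y i)) * geom (\<theta> (X i))) * R"
    unfolding prod_split[OF M(2,3)] R_def
    by (intro arg_cong2[of _ _ _ _ "(*)"] prod.cong) (auto simp: \<theta>_def)
  also have "(\<Prod>i\<in>{1..M}. lin (- \<theta> (Y i)) * geom (\<theta> (X i))) = (\<Prod>i\<in>{1..M}. lin (- \<theta> (Y i)))"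
  proof (rule prod.cong)
    have "geom (0::complex) = 1" using lin_geom[of "0::complex"] by simp
    then show "lin (- \<theta> (Y i)) * geom (\<theta> (X i)) = lin (- \<theta> (Y i))" if "i \<in> {1..M}" for i
      using that by (simp add: \<theta>_def)
  qed simp
  also have "\<dots> = (\<Prod>i\<in>{1..int K}. lin (- \<theta> (Y i)))"
    by (rule prod.mono_neutral_right) (use M in \<open>auto simp: \<theta>_def\<close>)
  also have "\<dots> = (\<Prod>j<K. lin (r j))"
    by (rule prod.reindex_bij_witness[of _ "\<lambda>j. int j + 1" "\<lambda>i. nat (i - 1)"])
       (use M in \<open>auto simp: \<theta>_def\<close>)
  finally have chern: "ev_fps \<theta> (chern_value m) = (\<Prod>j<K. lin (r j)) * R" .
  have "fps_nth ((\<Prod>j<K. lin (r j)) * R) n = fps_nth c n" if "n \<le> K" for n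
  proof -
    have "fps_nth ((\<Prod>j<K. lin (r j)) * R) n = fps_nth (c * S * R) n"
      unfolding fps_mult_nth[of _ R] by (rule sum.cong) (use r that in auto)
    then show ?thesis by (simp add: mult.assoc RS)
  qed
  then have "ev \<theta> (spec m (C k)) = \<rho> (C k)" if "k < K" for k
    using that arg_cong[OF chern, of "\<lambda>s. fps_nth s (Suc k)"] by (simp add: spec_def c_def)
  moreover have "ev \<theta> (spec m (X i)) = \<rho> (X i)" "ev \<theta> (spec m (Y i)) = \<rho> (Y i)" if "i \<ge> - N" for i
    using that by (simp_all add: \<theta>_def M_def)
  ultimately show ?thesis by blast
qed

lemma spec_vanishing:
  assumes "\<And>m. m \<ge> m0 \<Longrightarrow> ev (spec m) f = 0"
  shows "f = 0"
proof -
  obtain B where B: "finite B" "f \<in> gen B"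
    using gen_finite[OF gen_UNIV] by blast
  define h where "h v = (case v of C k \<Rightarrow> int k | X i \<Rightarrow> \<bar>i\<bar> | Y i \<Rightarrow> \<bar>i\<bar>)" for v
  have "bdd_above (h ` B)" using B(1) by (intro bdd_above_finite finite_imageI)
  then obtain N0 where N0: "\<And>v. v \<in> B \<Longrightarrow> h v \<le> N0" by (auto simp: bdd_above_def)
  define N where "N = max 0 N0"
  have N: "0 \<le> N" "\<And>v. v \<in> B \<Longrightarrow> h v \<le> N" using N0 by (force simp: N_def)+
  \<comment> \<open>Here K = N + 1 covers each \<open>C k\<close> with k <= N, and K + N < 2 N +
    2.\<close>
  define m where "m = max m0 (2 * N + 2)"
  show ?thesis
  proof (rule ev_complex_vanishing[OF B])
    fix \<rho> :: "indet \<Rightarrow> complex"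
    have "int (nat N + 1) + N < m" using N(1) unfolding m_def by linarith
    then obtain \<theta> where \<theta>: "\<And>k. k < nat N + 1 \<Longrightarrow> ev \<theta> (spec m (C k)) = \<rho> (C k)"
      "\<And>i. i \<ge> - N \<Longrightarrow> ev \<theta> (spec m (X i)) = \<rho> (X i)"
      "\<And>i. i \<ge> - N \<Longrightarrow> ev \<theta> (spec m (Y i)) = \<rho> (Y i)"
      using spec_surjective[of "nat N + 1" N m \<rho>] N(1) by blast
    have "ev \<theta> (spec m v) = \<rho> v" if "v \<in> B" for v
      using N(2)[OF that] \<theta> by (cases v) (auto simp: h_def simp del: spec_simps)
    then have "ev \<rho> f = ev \<theta> (ev (spec m) f)"
      unfolding ev_ev by (intro ev_cong_gen[OF B(2)]) simp
    then show "ev \<rho> f = 0" using assms[of m] by (simp add: m_def)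
  qed
qed

theorem theorem1p2:
  fixes w :: "int \<Rightarrow> int"
  assumes "w \<in> S_Z"
  shows "\<exists>!F :: cxy_poly. \<forall>m::int. m > 0 \<and> gamma_perm m w \<in> S_plus \<longrightarrow>
           c_zero (gamma m F) = neg_y (double_schubert (gamma_perm m w))"
proof (rule ex_ex1I[OF back_stable_exists[OF assms]])
  fix F G
  assume F: "\<forall>m::int. m > 0 \<and> gamma_perm m w \<in> S_plus \<longrightarrow>
      c_zero (gamma m F) = neg_y (double_schubert (gamma_perm m w))"
    and G: "\<forall>m::int. m > 0 \<and> gamma_perm m w \<in> S_plus \<longrightarrow>
      c_zero (gamma m G) = neg_y (double_schubert (gamma_perm m w))"
  obtain n where n: "\<And>i. i < -n \<Longrightarrow> w i = i" "\<And>i. i > n \<Longrightarrow> w i = i"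
    using S_Z_bounded[OF assms] by blast
  have "F - G = 0"
  proof (rule spec_vanishing)
    \<comment> \<open>From m = n + 1 on, all moved points, being at least -n, are shifted to
      positive ones.\<close>
    fix m assume m: "m \<ge> max 1 (n + 1)"
    have "gamma_perm m w \<in> S_plus"
      using m by (intro gamma_perm_S_plus[OF S_Z_bij[OF assms], of "- n - 1" n]) (auto simp: n)
    then have "c_zero (gamma m F) = c_zero (gamma m G)" using F G m by simp
    then show "ev (spec m) (F - G) = 0" using m by (simp add: c_zero_gamma ev_diff)
  qed
  then show "F = G" by simp
qed

end
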